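(* Let $\psi(x)=\frac{\Gamma'(x)}{\Gamma(x)}$ denote the logarithmic derivative of Euler's gamma function $\Gamma$ on $(0,\infty)$, and define $$\Psi(x)=[\psi'(x)]^2+\psi''(x),\qquad x\in(0,\infty).$$ Then the completely monotonic degree of $\Psi(x)$ with respect to $x\in(0,\infty)$ is $4$.
   Context: A function $f$ is completely monotonic on an interval $I$ if it has derivatives of all orders on $I$ and $0\le(-1)^{k-1}f^{(k-1)}(x)<\infty$ for all $x\in I$ and all $k\in\mathbb{N}=\{1,2,\dots\}$, where $f^{(0)}=f$. Completely monotonic degree: let $f$ be a completely monotonic function on $(0,\infty)$ and put $f(\infty)=\lim_{x\to\infty}f(x)$. If for some $r\in\mathbb{R}$ the function $x^r[f(x)-f(\infty)]$ is completely monotonic on $(0,\infty)$, but $x^{r+\varepsilon}[f(x)-f(\infty)]$ is not completely monotonic on $(0,\infty)$ for any $\varepsilon>0$, then $r$ is called the completely monotonic degree of $f(x)$ with respect to $x\in(0,\infty)$. If $x^r[f(x)-f(\infty)]$ is completely monotonic on $(0,\infty)$ for every $r\in\mathbb{R}$, the degree is said to be $\infty$. The gamma function is $\Gamma(x)=\int_0^\infty t^{x-1}e^{-t}\,dt$ for $x>0$. *)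

theory Defs
  imports "HOL-Analysis.Analysis"
begin

(* The witness D lists the derivatives D k = f^(k) on I (one-sided at an endpoint belonging
   to I). On an interval with more than one point, I and f determine each D k on I. *)
definition completely_monotonic_on :: "real set \<Rightarrow> (real \<Rightarrow> real) \<Rightarrow> bool" where
  "completely_monotonic_on I f \<longleftrightarrow>
     (\<exists>D :: nat \<Rightarrow> real \<Rightarrow> real.
        (\<forall>x\<in>I. D 0 x = f x) \<and>
        (\<forall>k. \<forall>x\<in>I. (D k has_real_derivative D (Suc k) x) (at x within I)) \<and>
        (\<forall>k. \<forall>x\<in>I. 0 \<le> (-1) ^ k * D k x))"

(* A relation, because the degree of f is only a partial notion; it is unique when it exists.
   The limit at infinity exists for every completely monotonic f, which is nonnegative and
   nonincreasing, so Lim is meaningful here. *)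
definition has_cm_degree :: "(real \<Rightarrow> real) \<Rightarrow> ereal \<Rightarrow> bool" where
  "has_cm_degree f d \<longleftrightarrow>
     completely_monotonic_on {0<..} f \<and>
     (let cm_power = (\<lambda>r::real.
            completely_monotonic_on {0<..} (\<lambda>x. x powr r * (f x - Lim at_top f)))
      in case d of
           ereal r \<Rightarrow> cm_power r \<and> (\<forall>\<epsilon>>0. \<not> cm_power (r + \<epsilon>))
         | PInfty \<Rightarrow> (\<forall>r. cm_power r)
         | MInfty \<Rightarrow> False)"

definition psi :: "real \<Rightarrow> real" where
  "psi x = deriv Gamma x / Gamma x"

definition Psi :: "real \<Rightarrow> real" where
  "Psi x = (deriv psi x)\<^sup>2 + deriv (deriv psi) x"

end

theory Submission
  imports Defs "HOL-Probability.Sinc_Integral" "HOL-Real_Asymp.Real_Asymp"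
begin

text \<open>
  Why the degree is \<open>4\<close>. Write \<open>kap y = y coth y - 1\<close>, let \<open>Kap2\<close> be its double primitive with
  \<open>Kap2 0 = Kap2' 0 = 0\<close>, and let \<open>q = Kap2 * (1 + coth)\<close>. The variable \<open>y\<close> is half of the usual
  variable \<open>t\<close> in \<open>\<psi>' x = \<integral> t / (1 - exp (- t)) * exp (- x t) dt\<close>, because
  \<open>2 / (1 - exp (- 2 y)) = 1 + coth y\<close>.

  Representation. The recurrences of the polygamma functions give
  \<open>Psi x - Psi (x + 1) = 2 / x\<^sup>2 * (\<psi>' x - 1 / x - 1 / (2 x\<^sup>2))\<close>, where the right-hand side is a
  multiple of the Laplace transform of \<open>Kap2\<close> at \<open>2 x\<close>. Multiplying a kernel by \<open>1 - exp (- 2 y)\<close>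
  takes a difference of its transform, so the transform of \<open>q\<close> solves the same difference equation
  (\<open>Psi_laplace\<close>). As \<open>q\<close>, \<open>q'\<close>, \<open>q''\<close> tend to \<open>0\<close> and \<open>q'''\<close> tends to \<open>1 / 6\<close> at \<open>0\<close>, four
  integrations by parts yield \<open>x ^ 4 * Psi x = 1 / 12 + 1 / 2 * laplace q'''' (2 x)\<close>
  (\<open>power4_times_Psi\<close>).

  Degree at least \<open>4\<close>. By this formula it suffices that \<open>q'''' \<ge> 0\<close>. Up to a positive factor,
  \<open>q''''\<close> equals \<open>Kap2 - R * Kap1 + W\<close>, where \<open>Kap1 = Kap2'\<close> and \<open>R\<close>, \<open>W\<close> are rational in \<open>y\<close> and
  \<open>T = tanh y\<close>. This combination (\<open>q4_core\<close>) vanishes at \<open>0\<close>, and its derivative is free of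
  \<open>Kap2\<close>; it still contains \<open>Kap1\<close>, with a coefficient that has the sign of \<open>2 T\<^sup>2 - 1\<close>. An upper bound for \<open>Kap1\<close> where \<open>T\<^sup>2 \<le> 1 / 2\<close> and a linear lower bound where
  \<open>T\<^sup>2 \<ge> 1 / 2\<close> turn the positivity of this derivative into polynomial inequalities
  (\<open>slope_numerator_nonneg\<close>). That \<open>Psi\<close> itself is completely monotonic is seen from \<open>q \<ge> 0\<close>;
  moreover \<open>Psi x\<close> is at most \<open>Psi 1 / x ^ 4\<close> for \<open>x \<ge> 1\<close>, so its limit at infinity is \<open>0\<close>.

  Degree at most \<open>4\<close>. The formula also gives \<open>x ^ 4 * Psi x \<ge> 1 / 12\<close>, so
  \<open>x powr (4 + \<epsilon>) * Psi x\<close> is unbounded at infinity for every \<open>\<epsilon> > 0\<close>, whereas a completely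
  monotonic function is nonincreasing.
\<close>

section \<open>Laplace transforms on the half-line\<close>

text \<open>
  Convergence is asked for all \<open>s > 0\<close> at once, because convergence at \<open>s / 2\<close> is what controls
  the derivatives of the transform at \<open>s\<close>.
\<close>
definition laplace_converges :: "(real \<Rightarrow> real) \<Rightarrow> bool" where
  "laplace_converges f \<longleftrightarrow> (\<forall>s>0. set_integrable lborel {0<..} (\<lambda>y. exp (- s * y) * f y))"

definition laplace :: "(real \<Rightarrow> real) \<Rightarrow> real \<Rightarrow> real" where
  "laplace f s = (LBINT y:{0<..}. exp (- s * y) * f y)"

lemma laplace_convergesD:
  "laplace_converges f \<Longrightarrow> s > 0 \<Longrightarrow> set_integrable lborel {0<..} (\<lambda>y. exp (- s * y) * f y)"
  by (simp add: laplace_converges_def)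

lemma laplace_converges_add:
  "laplace_converges f \<Longrightarrow> laplace_converges g \<Longrightarrow> laplace_converges (\<lambda>y. f y + g y)"
  unfolding laplace_converges_def by (auto simp: distrib_left intro: set_integral_add)

lemma laplace_add:
  "laplace_converges f \<Longrightarrow> laplace_converges g \<Longrightarrow> s > 0 \<Longrightarrow>
     laplace (\<lambda>y. f y + g y) s = laplace f s + laplace g s"
  unfolding laplace_def distrib_left by (rule set_integral_add) (rule laplace_convergesD; assumption)+

lemma laplace_converges_cmult:
  "laplace_converges f \<Longrightarrow> laplace_converges (\<lambda>y. c * f y)"
  unfolding laplace_converges_def by (simp add: mult.left_commute)

lemma laplace_cmult: "laplace (\<lambda>y. c * f y) s = c * laplace f s"
  unfolding laplace_def by (simp add: mult.left_commute)

lemma laplace_cong: "(\<And>y. y > 0 \<Longrightarrow> f y = g y) \<Longrightarrow> laplace f s = laplace g s"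
  unfolding laplace_def by (rule set_lebesgue_integral_cong) auto

lemma laplace_converges_cong:
  assumes "\<And>y. y > 0 \<Longrightarrow> f y = g y"
  shows "laplace_converges f \<longleftrightarrow> laplace_converges g"
  unfolding laplace_converges_def
  by (intro all_cong set_integrable_cong) (use assms in auto)

lemma laplace_nonneg: "(\<And>y. y > 0 \<Longrightarrow> f y \<ge> 0) \<Longrightarrow> laplace f s \<ge> 0"
  unfolding laplace_def set_lebesgue_integral_def
  by (rule integral_nonneg_AE) (auto simp: indicator_def)

lemma linear_times_exp_le:
  fixes s y :: real
  assumes "s > 0"
  shows "y * exp (- s * y) \<le> (2 / s) * exp (- (s / 2) * y)"
proof -
  have "s / 2 * y \<le> exp (s / 2 * y)"
    using exp_ge_add_one_self[of "s / 2 * y"] by linarith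
  hence "y \<le> (2 / s) * exp (s / 2 * y)"
    using assms by (simp add: field_simps)
  hence "y * exp (- s * y) \<le> (2 / s) * exp (s / 2 * y) * exp (- s * y)"
    by (rule mult_right_mono) simp
  also have "\<dots> = (2 / s) * exp (- (s / 2) * y)"
    by (simp add: mult.assoc flip: exp_add)
  finally show ?thesis .
qed

text \<open>
  Half of the exponential decay absorbs the extra factor \<open>y\<close>.
\<close>
lemma laplace_converges_times_id:
  assumes "laplace_converges f"
  shows "laplace_converges (\<lambda>y. y * f y)"
  unfolding laplace_converges_def
proof safe
  fix s :: real assume s: "s > 0"
  let ?g = "\<lambda>y. exp (- (s / 2) * y) * f y"
  have int: "set_integrable lborel {0<..} (\<lambda>y. (2 / s) * ?g y)"
    using laplace_convergesD[OF assms, of "s / 2"] s by simp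
  have "(\<lambda>y. indicator {0<..} y *\<^sub>R ?g y) \<in> borel_measurable lborel"
    using laplace_convergesD[OF assms, of "s / 2"] s
    by (auto simp: set_integrable_def dest: borel_measurable_integrable)
  hence "(\<lambda>y. (y * exp (- (s / 2) * y)) * (indicator {0<..} y *\<^sub>R ?g y)) \<in> borel_measurable lborel"
    by (intro borel_measurable_times) auto
  also have "(\<lambda>y. (y * exp (- (s / 2) * y)) * (indicator {0<..} y *\<^sub>R ?g y)) =
      (\<lambda>y. indicator {0<..} y *\<^sub>R (exp (- s * y) * (y * f y)))"
  proof
    fix y :: real
    have "exp (- (s / 2) * y) * exp (- (s / 2) * y) = exp (- s * y)"
      by (simp flip: exp_add)
    hence "y * indicator {0<..} y * f y * (exp (- (s / 2) * y) * exp (- (s / 2) * y)) =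
        y * indicator {0<..} y * f y * exp (- s * y)"
      by (rule arg_cong)
    thus "(y * exp (- (s / 2) * y)) * (indicator {0<..} y *\<^sub>R ?g y) =
      indicator {0<..} y *\<^sub>R (exp (- s * y) * (y * f y))"
      by (simp only: mult_ac real_scaleR_def)
  qed
  finally have meas: "set_borel_measurable lborel {0<..} (\<lambda>y. exp (- s * y) * (y * f y))"
    by (simp add: set_borel_measurable_def)
  show "set_integrable lborel {0<..} (\<lambda>y. exp (- s * y) * (y * f y))"
  proof (rule set_integrable_bound[OF int meas], rule AE_I2, rule impI)
    fix y :: real assume y: "y \<in> {0<..}"
    have "norm (exp (- s * y) * (y * f y)) = (y * exp (- s * y)) * \<bar>f y\<bar>"
      using y by (simp add: abs_mult)
    also have "\<dots> \<le> ((2 / s) * exp (- (s / 2) * y)) * \<bar>f y\<bar>"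
      by (intro mult_right_mono linear_times_exp_le s) simp
    also have "\<dots> = norm ((2 / s) * ?g y)"
      using s by (simp add: abs_mult)
    finally show "norm (exp (- s * y) * (y * f y)) \<le> norm ((2 / s) * ?g y)" .
  qed
qed

lemma abs_exp_minus_one_le: "\<bar>exp u - 1\<bar> \<le> \<bar>u\<bar> * exp \<bar>u\<bar>" for u :: real
proof (cases "u \<ge> 0")
  case True
  have "(1 - u) * exp u \<le> exp (- u) * exp u"
    using exp_ge_add_one_self[of "- u"] by (intro mult_right_mono) auto
  thus ?thesis using True by (simp add: algebra_simps flip: exp_add)
next
  case False
  have "1 - exp u \<le> - u" using exp_ge_add_one_self[of u] by linarith
  also have "- u \<le> - u * exp (- u)" using False by (intro mult_le_cancel_left1[THEN iffD2]) auto
  finally show ?thesis using False by simp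
qed

text \<open>
  Differentiation under the integral sign. For \<open>\<bar>h\<bar> < s / 2\<close> the difference quotient of the
  integrand is dominated by \<open>y exp (- s y / 2) \<bar>f y\<bar>\<close>, which is integrable.
\<close>
lemma has_real_derivative_laplace:
  assumes f: "laplace_converges f" and s: "s > 0"
  shows "(laplace f has_real_derivative laplace (\<lambda>y. - y * f y) s) (at s)"
proof -
  let ?S = "{- s / 2 <..< s / 2}"
  let ?q = "\<lambda>h y. indicator {0<..} y *\<^sub>R ((exp (- (s + h) * y) - exp (- s * y)) / h * f y)"
  let ?w = "\<lambda>y. indicator {0<..} y *\<^sub>R (exp (- (s / 2) * y) * (y * f y))"
  have int: "set_integrable lborel {0<..} (\<lambda>y. exp (- (s + h) * y) * f y)" if "h \<in> ?S" for h
    by (rule laplace_convergesD[OF f]) (use that s in auto)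
  have int0: "set_integrable lborel {0<..} (\<lambda>y. exp (- s * y) * f y)"
    by (rule laplace_convergesD[OF f s])
  have quot: "(laplace f (s + h) - laplace f s) / h = integral\<^sup>L lborel (?q h)"
       and meas: "?q h \<in> borel_measurable lborel" if "h \<in> ?S" for h
  proof -
    have eq: "?q h = (\<lambda>y. indicator {0<..} y *\<^sub>R
        ((exp (- (s + h) * y) * f y - exp (- s * y) * f y) / h))"
      by (auto simp: algebra_simps diff_divide_distrib)
    have "set_integrable lborel {0<..} (\<lambda>y. (exp (- (s + h) * y) * f y - exp (- s * y) * f y) / h)"
      using set_integral_diff(1)[OF int[OF that] int0] by simp
    thus "?q h \<in> borel_measurable lborel"
      unfolding eq set_integrable_def by (rule borel_measurable_integrable)
    show "(laplace f (s + h) - laplace f s) / h = integral\<^sup>L lborel (?q h)"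
      unfolding eq laplace_def set_integral_diff(2)[OF int[OF that] int0, symmetric]
      by (subst set_integral_divide_zero[symmetric]) (simp add: set_lebesgue_integral_def)
  qed
  have bound: "norm (?q h y) \<le> norm (?w y)" if "h \<in> ?S" "h \<noteq> 0" for h y
  proof (cases "y > 0")
    case y: True
    have "\<bar>exp (- (s + h) * y) - exp (- s * y)\<bar> = exp (- s * y) * \<bar>exp (- h * y) - 1\<bar>"
    proof -
      have "exp (- (s + h) * y) - exp (- s * y) = exp (- s * y) * (exp (- h * y) - 1)"
        by (simp add: algebra_simps flip: exp_add)
      thus ?thesis by (simp add: abs_mult)
    qed
    also have "\<dots> \<le> exp (- s * y) * (\<bar>- h * y\<bar> * exp \<bar>- h * y\<bar>)"
      by (intro mult_left_mono abs_exp_minus_one_le) simp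
    also have "\<dots> = \<bar>h\<bar> * (y * exp (- (s - \<bar>h\<bar>) * y))"
      using y by (simp add: abs_mult algebra_simps flip: exp_add)
    also have "\<dots> \<le> \<bar>h\<bar> * (y * exp (- (s / 2) * y))"
    proof -
      have "(s / 2) * y \<le> (s - \<bar>h\<bar>) * y"
        using that y by (intro mult_right_mono) (auto simp: abs_if)
      hence "exp (- (s - \<bar>h\<bar>) * y) \<le> exp (- (s / 2) * y)"
        by (simp only: exp_le_cancel_iff mult_minus_left neg_le_iff_le)
      thus ?thesis using y by (intro mult_left_mono) auto
    qed
    finally have "\<bar>exp (- (s + h) * y) - exp (- s * y)\<bar> / \<bar>h\<bar> \<le> y * exp (- (s / 2) * y)"
      using that by (simp add: field_simps)
    hence "\<bar>exp (- (s + h) * y) - exp (- s * y)\<bar> / \<bar>h\<bar> * \<bar>f y\<bar> \<le> y * exp (- (s / 2) * y) * \<bar>f y\<bar>"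
      by (rule mult_right_mono) simp
    thus ?thesis using y by (simp add: abs_mult mult_ac)
  qed auto
  have w: "integrable lborel (\<lambda>y. norm (?w y))"
    using laplace_convergesD[OF laplace_converges_times_id[OF f], of "s / 2"] s
    by (auto simp: set_integrable_def intro!: integrable_norm)
  have meas': "(\<lambda>y. indicator {0<..} y *\<^sub>R (exp (- s * y) * (- y * f y))) \<in> borel_measurable lborel"
    using laplace_convergesD[OF laplace_converges_cmult[OF laplace_converges_times_id[OF f], of "-1"] s]
    by (auto simp: set_integrable_def dest: borel_measurable_integrable)
  have lim: "((\<lambda>h. ?q h y) \<longlongrightarrow> indicator {0<..} y *\<^sub>R (exp (- s * y) * (- y * f y))) (at 0)" for y
  proof -
    have "((\<lambda>h. exp (- h * y)) has_real_derivative - y * exp (- s * y)) (at s)"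
      by (auto intro!: derivative_eq_intros)
    hence "((\<lambda>h. (exp (- (s + h) * y) - exp (- s * y)) / h) \<longlongrightarrow> - y * exp (- s * y)) (at 0)"
      unfolding DERIV_def .
    hence "((\<lambda>h. indicator {0<..} y *\<^sub>R ((exp (- (s + h) * y) - exp (- s * y)) / h * f y)) \<longlongrightarrow>
             indicator {0<..} y *\<^sub>R (- y * exp (- s * y) * f y)) (at 0)"
      by (intro tendsto_intros)
    thus ?thesis by (simp only: mult_ac)
  qed
  have "((\<lambda>h. integral\<^sup>L lborel (?q h)) \<longlongrightarrow> laplace (\<lambda>y. - y * f y) s) (at 0 within ?S)"
    unfolding tendsto_at_iff_sequentially
  proof (intro allI impI)
    fix X :: "nat \<Rightarrow> real" assume X: "\<forall>i. X i \<in> ?S - {0}" "X \<longlonglongrightarrow> 0"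
    have "(\<lambda>i. integral\<^sup>L lborel (?q (X i))) \<longlonglongrightarrow>
            integral\<^sup>L lborel (\<lambda>y. indicator {0<..} y *\<^sub>R (exp (- s * y) * (- y * f y)))"
    proof (rule integral_dominated_convergence[OF meas' _ w])
      show "?q (X i) \<in> borel_measurable lborel" for i using meas X by auto
      show "AE y in lborel. (\<lambda>i. ?q (X i) y) \<longlonglongrightarrow> indicator {0<..} y *\<^sub>R (exp (- s * y) * (- y * f y))"
        using lim X unfolding tendsto_at_iff_sequentially o_def by (intro AE_I2) blast
      show "AE y in lborel. norm (?q (X i) y) \<le> norm (?w y)" for i
        using bound X by (intro AE_I2) blast
    qed
    thus "((\<lambda>h. integral\<^sup>L lborel (?q h)) \<circ> X) \<longlonglongrightarrow> laplace (\<lambda>y. - y * f y) s"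
      by (simp add: o_def laplace_def set_lebesgue_integral_def)
  qed
  hence "((\<lambda>h. (laplace f (s + h) - laplace f s) / h) \<longlongrightarrow> laplace (\<lambda>y. - y * f y) s) (at 0 within ?S)"
    by (rule Lim_transform_eventually)
       (unfold eventually_at_filter, intro always_eventually allI impI quot[symmetric])
  moreover have "at 0 within ?S = at 0"
    by (rule at_within_open) (use s in auto)
  ultimately show ?thesis by (simp add: DERIV_def)
qed

lemma laplace_tendsto_0:
  assumes f: "laplace_converges f" and s: "s > 0"
  shows "(\<lambda>n. laplace f (s + of_nat n)) \<longlonglongrightarrow> 0"
proof -
  let ?g = "\<lambda>r y. indicator {0<..} y *\<^sub>R (exp (- r * y) * f y)"
  have int: "integrable lborel (?g r)" if "r > 0" for r
    using laplace_convergesD[OF f that] by (simp add: set_integrable_def)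
  have "(\<lambda>n. integral\<^sup>L lborel (?g (s + of_nat n))) \<longlonglongrightarrow> integral\<^sup>L lborel (\<lambda>y::real. 0 :: real)"
  proof (rule integral_dominated_convergence[where w = "\<lambda>y. norm (?g s y)"])
    show "?g (s + of_nat n) \<in> borel_measurable lborel" for n
      using int[of "s + of_nat n"] s by (auto dest: borel_measurable_integrable)
    show "AE y in lborel. (\<lambda>n. ?g (s + of_nat n) y) \<longlonglongrightarrow> 0"
    proof (rule AE_I2)
      fix y :: real
      show "(\<lambda>n. ?g (s + of_nat n) y) \<longlonglongrightarrow> 0"
      proof (cases "y > 0")
        case True
        have "(\<lambda>n. exp (- (s + of_nat n) * y)) \<longlonglongrightarrow> 0"
          using True by real_asymp
        from tendsto_mult_left_zero[OF this, of "f y"] True show ?thesis by simp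
      qed auto
    qed
    show "AE y in lborel. norm (?g (s + of_nat n) y) \<le> norm (?g s y)" for n
      by (intro AE_I2) (auto simp: abs_mult indicator_def algebra_simps intro!: mult_left_mono)
  qed (use int[OF s] in auto)
  thus ?thesis by (simp add: laplace_def set_lebesgue_integral_def)
qed

text \<open>
  Integration by parts, that is, the fundamental theorem of calculus for \<open>exp (- s y) * f y\<close>.
\<close>
lemma laplace_derivative:
  assumes f: "\<And>y. y > 0 \<Longrightarrow> (f has_real_derivative f' y) (at y)"
    and f': "continuous_on {0<..} f'"
    and conv: "laplace_converges f" "laplace_converges f'"
    and lim0: "(f \<longlongrightarrow> f0) (at_right 0)"
    and lim: "((\<lambda>y. exp (- s * y) * f y) \<longlongrightarrow> 0) at_top"
    and s: "s > 0"
  shows "s * laplace f s = f0 + laplace f' s"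
proof -
  let ?F = "\<lambda>y. exp (- s * y) * f y"
  let ?F' = "\<lambda>y. exp (- s * y) * f' y + (- s) * (exp (- s * y) * f y)"
  have contf: "isCont f y" if "y > 0" for y
    using f[OF that] by (rule DERIV_isCont)
  have contf': "isCont f' y" if "y > 0" for y
    using f' that by (auto simp: continuous_on_eq_continuous_at)
  have int: "set_integrable lborel {0<..} ?F'"
    by (intro set_integral_add(1) set_integrable_mult_right laplace_convergesD conv s)
  have "(LBINT y=ereal 0..\<infinity>. ?F' y) = 0 - f0"
  proof (rule interval_integral_FTC_integrable)
    show "(?F has_vector_derivative ?F' y) (at y)" if "ereal 0 < ereal y" for y
      using that f[of y] unfolding has_real_derivative_iff_has_vector_derivative[symmetric]
      by (auto intro!: derivative_eq_intros)
    show "isCont ?F' y" if "ereal 0 < ereal y" for y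
      using that contf[of y] contf'[of y] by (auto intro!: continuous_intros)
    show "set_integrable lborel (einterval (ereal 0) \<infinity>) ?F'"
      using int by simp
    have "(?F \<longlongrightarrow> exp (- s * 0) * f0) (at_right 0)"
      by (intro tendsto_intros lim0)
    thus "((?F \<circ> real_of_ereal) \<longlongrightarrow> f0) (at_right (ereal 0))"
      by (simp add: ereal_tendsto_simps)
    show "((?F \<circ> real_of_ereal) \<longlongrightarrow> 0) (at_left \<infinity>)"
      using lim by (simp add: ereal_tendsto_simps)
  qed auto
  hence "(LBINT y:{0<..}. ?F' y) = - f0"
    by (simp add: interval_integral_to_infinity_eq)
  moreover have "(LBINT y:{0<..}. ?F' y) = laplace f' s + (- s) * laplace f s"
    unfolding laplace_def
    unfolding set_integral_mult_right[symmetric]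
    by (intro set_integral_add(2) set_integrable_mult_right laplace_convergesD conv s)
  ultimately show ?thesis by simp
qed

text \<open>
  A nonnegative derivative of a function with finite limits at both ends is integrable; no bound
  on \<open>f'\<close> itself is involved.
\<close>
lemma laplace_convergesI_nonneg:
  assumes f: "\<And>y. y > 0 \<Longrightarrow> (f has_real_derivative f' y) (at y)"
    and f': "continuous_on {0<..} f'" and nonneg: "\<And>y. y > 0 \<Longrightarrow> f' y \<ge> 0"
    and lim0: "(f \<longlongrightarrow> a) (at_right 0)" and lim: "(f \<longlongrightarrow> b) at_top"
  shows "laplace_converges f'"
  unfolding laplace_converges_def
proof safe
  fix s :: real assume s: "s > 0"
  have contf': "isCont f' y" if "y > 0" for y
    using f' that by (auto simp: continuous_on_eq_continuous_at)
  have int: "set_integrable lborel (einterval (ereal 0) \<infinity>) f'"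
  proof (rule interval_integral_FTC_nonneg(1))
    show "((f \<circ> real_of_ereal) \<longlongrightarrow> a) (at_right (ereal 0))"
      using lim0 by (simp add: ereal_tendsto_simps)
    show "((f \<circ> real_of_ereal) \<longlongrightarrow> b) (at_left \<infinity>)"
      using lim by (simp add: ereal_tendsto_simps)
  qed (use f contf' nonneg in auto)
  show "set_integrable lborel {0<..} (\<lambda>y. exp (- s * y) * f' y)"
  proof (rule set_integrable_bound)
    show "set_integrable lborel {0<..} f'" using int by simp
    have "set_borel_measurable borel {0<..} (\<lambda>y. exp (- s * y) * f' y)"
      by (intro borel_measurable_continuous_on_indicator continuous_intros f'
            set_measurable_continuous_on) auto
    thus "set_borel_measurable lborel {0<..} (\<lambda>y. exp (- s * y) * f' y)"
      by (simp add: set_borel_measurable_def)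
    show "AE y in lborel. y \<in> {0<..} \<longrightarrow> norm (exp (- s * y) * f' y) \<le> norm (f' y)"
      using s by (intro AE_I2) (auto simp: abs_mult intro!: mult_left_le_one_le)
  qed
qed

section \<open>Functions of subexponential growth\<close>

definition subexponential :: "(real \<Rightarrow> real) \<Rightarrow> bool" where
  "subexponential f \<longleftrightarrow> (\<forall>s>0. \<exists>C. \<forall>y>0. \<bar>f y\<bar> \<le> C * exp (s * y))"

lemma subexponential_const: "subexponential (\<lambda>_. c)"
  unfolding subexponential_def
  by (intro allI impI exI[of _ "\<bar>c\<bar>"]) (auto simp: mult_le_cancel_left1)

lemma subexponential_id: "subexponential (\<lambda>y. y)"
  unfolding subexponential_def
proof (intro allI impI)
  fix s :: real assume s: "s > 0"
  show "\<exists>C. \<forall>y>0. \<bar>y\<bar> \<le> C * exp (s * y)"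
  proof (intro exI[of _ "1 / s"] allI impI)
    fix y :: real assume y: "y > 0"
    have "s * y \<le> exp (s * y)" using exp_ge_add_one_self[of "s * y"] by linarith
    thus "\<bar>y\<bar> \<le> 1 / s * exp (s * y)" using s y by (simp add: field_simps)
  qed
qed

lemma subexponential_mult:
  assumes "subexponential f" "subexponential g"
  shows "subexponential (\<lambda>y. f y * g y)"
  unfolding subexponential_def
proof (intro allI impI)
  fix s :: real assume s: "s > 0"
  obtain C D where C: "\<forall>y>0. \<bar>f y\<bar> \<le> C * exp (s / 2 * y)"
    and D: "\<forall>y>0. \<bar>g y\<bar> \<le> D * exp (s / 2 * y)"
    using assms s unfolding subexponential_def by (meson half_gt_zero)
  show "\<exists>C. \<forall>y>0. \<bar>f y * g y\<bar> \<le> C * exp (s * y)"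
  proof (intro exI[of _ "C * D"] allI impI)
    fix y :: real assume y: "y > 0"
    have "\<bar>f y * g y\<bar> \<le> (C * exp (s / 2 * y)) * (D * exp (s / 2 * y))"
      unfolding abs_mult using C D y
      by (intro mult_mono) (auto intro: order_trans[OF abs_ge_zero])
    also have "\<dots> = C * D * exp (s * y)"
      by (simp add: mult_ac flip: exp_add)
    finally show "\<bar>f y * g y\<bar> \<le> C * D * exp (s * y)" .
  qed
qed

lemma subexponential_power: "subexponential f \<Longrightarrow> subexponential (\<lambda>y. f y ^ n)"
  by (induction n) (auto intro: subexponential_const subexponential_mult)

lemma subexponential_bound:
  assumes "subexponential g" "\<And>y. y > 0 \<Longrightarrow> \<bar>f y\<bar> \<le> g y"
  shows "subexponential f"
  using assms unfolding subexponential_def by (meson abs_ge_self order_trans)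

lemma subexponential_tendsto_0:
  assumes "subexponential f" "s > 0"
  shows "((\<lambda>y. exp (- s * y) * f y) \<longlongrightarrow> 0) at_top"
proof -
  obtain C where C: "\<forall>y>0. \<bar>f y\<bar> \<le> C * exp (s / 2 * y)"
    using assms unfolding subexponential_def by (meson half_gt_zero)
  have "((\<lambda>y. C * exp (- (s / 2) * y)) \<longlongrightarrow> 0) at_top"
    using assms(2) by real_asymp
  moreover have "eventually (\<lambda>y. norm (exp (- s * y) * f y) \<le> C * exp (- (s / 2) * y)) at_top"
    using eventually_gt_at_top[of 0]
  proof eventually_elim
    case (elim y)
    have "norm (exp (- s * y) * f y) \<le> exp (- s * y) * (C * exp (s / 2 * y))"
      using C elim by (simp add: abs_mult)
    also have "\<dots> = C * exp (- (s / 2) * y)"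
      by (simp add: mult_ac flip: exp_add)
    finally show ?case .
  qed
  ultimately show ?thesis by (rule Lim_null_comparison[rotated])
qed

lemma laplace_convergesI:
  assumes "subexponential f" "continuous_on {0<..} f"
  shows "laplace_converges f"
  unfolding laplace_converges_def
proof safe
  fix s :: real assume s: "s > 0"
  obtain C where C: "\<forall>y>0. \<bar>f y\<bar> \<le> C * exp (s / 2 * y)"
    using assms s unfolding subexponential_def by (meson half_gt_zero)
  show "set_integrable lborel {0<..} (\<lambda>y. exp (- s * y) * f y)"
  proof (rule set_integrable_bound)
    show "set_integrable lborel {0<..} (\<lambda>y. C * exp (- (y * (s / 2))))"
      by (intro set_integrable_mult_right integrable_I0i_exp_mscale) (use s in auto)
    have "set_borel_measurable borel {0<..} (\<lambda>y. exp (- s * y) * f y)"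
      by (intro set_measurable_continuous_on continuous_intros assms) auto
    thus "set_borel_measurable lborel {0<..} (\<lambda>y. exp (- s * y) * f y)"
      by (simp add: set_borel_measurable_def)
    have "norm (exp (- s * y) * f y) \<le> norm (C * exp (- (y * (s / 2))))" if "y > 0" for y
    proof -
      have "norm (exp (- s * y) * f y) \<le> exp (- s * y) * (C * exp (s / 2 * y))"
        using C that by (simp add: abs_mult)
      also have "\<dots> = C * exp (- (y * (s / 2)))"
        by (simp add: mult_ac flip: exp_add)
      finally show ?thesis by simp
    qed
    thus "AE y in lborel. y \<in> {0<..} \<longrightarrow>
            norm (exp (- s * y) * f y) \<le> norm (C * exp (- (y * (s / 2))))"
      by (intro AE_I2) auto
  qed
qed

lemma laplace_const: "s > 0 \<Longrightarrow> laplace (\<lambda>_. c) s = c / s"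
  using LBINT_I0i_exp_mscale[of s]
  by (simp add: laplace_def interval_lebesgue_integral_0_infty mult_ac)

lemma laplace_id: "s > 0 \<Longrightarrow> laplace (\<lambda>y. y) s = 1 / s\<^sup>2"
  using laplace_derivative[of "\<lambda>y. y" "\<lambda>_. 1" 0 s]
    subexponential_tendsto_0[OF subexponential_id, of s]
  by (simp add: laplace_const laplace_convergesI subexponential_const subexponential_id
      field_simps power2_eq_square)

text \<open>
  This turns a functional equation in the variable \<open>s\<close> into an algebraic identity between
  integrands.
\<close>
lemma laplace_mult_exp: "laplace (\<lambda>y. exp (- a * y) * f y) s = laplace f (s + a)"
  unfolding laplace_def by (simp add: algebra_simps flip: exp_add mult.assoc)

section \<open>Inequalities for hyperbolic functions\<close>

lemma nonneg_if_deriv_nonneg: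
  fixes f :: "real \<Rightarrow> real"
  assumes "f 0 \<ge> 0" "continuous_on {0..y} f" "y \<ge> 0"
    and "\<And>x. 0 < x \<Longrightarrow> x < y \<Longrightarrow> \<exists>d. (f has_real_derivative d) (at x) \<and> d \<ge> 0"
  shows "f y \<ge> 0"
proof -
  have "f 0 \<le> f y"
    by (rule DERIV_nonneg_imp_increasing_open) (use assms in auto)
  with assms(1) show ?thesis by simp
qed

lemma tanh_square_less_one: "(tanh x)\<^sup>2 < 1" for x :: real
  using tanh_real_bounds[of x] by (simp add: abs_square_less_1 abs_less_iff)

lemma tanh_le_self:
  assumes "y \<ge> 0" shows "tanh y \<le> (y::real)"
proof -
  have "y - tanh y \<ge> 0"
  proof (rule nonneg_if_deriv_nonneg[of "\<lambda>y. y - tanh y"])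
    fix x :: real
    show "\<exists>d. ((\<lambda>y. y - tanh y) has_real_derivative d) (at x) \<and> d \<ge> 0"
      by (rule exI[of _ "(tanh x)\<^sup>2"]) (auto intro!: derivative_eq_intros)
  qed (use assms in \<open>auto intro!: continuous_intros\<close>)
  thus ?thesis by simp
qed

lemma tanh_ge_ratio:
  assumes "y \<ge> 0" shows "y \<le> (1 + y) * tanh (y::real)"
proof -
  have "(1 + y) * tanh y - y \<ge> 0"
  proof (rule nonneg_if_deriv_nonneg[of "\<lambda>y. (1 + y) * tanh y - y"])
    fix x :: real assume x: "0 < x"
    let ?T = "tanh x"
    have T: "0 \<le> ?T" "?T \<le> 1" using x tanh_real_lt_1[of x] by auto
    have "?T\<^sup>2 \<le> ?T" using T by (simp add: power2_eq_square mult_left_le)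
    hence "0 \<le> ?T - ?T\<^sup>2 + x * (1 - ?T\<^sup>2)" using x T by auto
    thus "\<exists>d. ((\<lambda>y. (1 + y) * tanh y - y) has_real_derivative d) (at x) \<and> d \<ge> 0"
      by (intro exI[of _ "?T - ?T\<^sup>2 + x * (1 - ?T\<^sup>2)"] conjI)
         (auto intro!: derivative_eq_intros simp: algebra_simps)
  qed (use assms in \<open>auto intro!: continuous_intros\<close>)
  thus ?thesis by simp
qed

text \<open>
  The start of the chain that produces the continued fraction of \<open>tanh\<close>: each of the next
  inequalities follows by integrating \<open>y\<close> times the one before it.
\<close>
lemma sinh_le_self_cosh:
  assumes "y \<ge> 0" shows "sinh y \<le> y * cosh (y::real)"
proof -
  have "y * cosh y - sinh y \<ge> 0"
  proof (rule nonneg_if_deriv_nonneg[of "\<lambda>y. y * cosh y - sinh y"])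
    fix x :: real assume x: "0 < x"
    show "\<exists>d. ((\<lambda>y. y * cosh y - sinh y) has_real_derivative d) (at x) \<and> d \<ge> 0"
      by (rule exI[of _ "x * sinh x"]) (use x in \<open>auto intro!: derivative_eq_intros\<close>)
  qed (use assms in \<open>auto intro!: continuous_intros\<close>)
  thus ?thesis by simp
qed

text \<open>
  A convergent of the continued fraction of \<open>tanh\<close>, with denominators cleared.
\<close>
lemma tanh_continued_fraction:
  assumes "y \<ge> 0" shows "(15 + 6 * y\<^sup>2) * tanh y \<le> y * (15 + (y::real)\<^sup>2)"
proof -
  have lower: "3 * y * cosh y \<le> (3 + y\<^sup>2) * sinh y" if "y \<ge> 0" for y :: real
  proof -
    have "(3 + y\<^sup>2) * sinh y - 3 * y * cosh y \<ge> 0"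
    proof (rule nonneg_if_deriv_nonneg[of "\<lambda>y. (3 + y\<^sup>2) * sinh y - 3 * y * cosh y"])
      fix x :: real assume x: "0 < x"
      show "\<exists>d. ((\<lambda>y. (3 + y\<^sup>2) * sinh y - 3 * y * cosh y) has_real_derivative d) (at x) \<and> d \<ge> 0"
        by (rule exI[of _ "x * (x * cosh x - sinh x)"])
           (use x sinh_le_self_cosh[of x] in
             \<open>auto intro!: derivative_eq_intros simp: algebra_simps power2_eq_square\<close>)
    qed (use that in \<open>auto intro!: continuous_intros\<close>)
    thus ?thesis by simp
  qed
  let ?f = "\<lambda>y::real. y * (15 + y\<^sup>2) * cosh y - (15 + 6 * y\<^sup>2) * sinh y"
  have "?f y \<ge> 0"
  proof (rule nonneg_if_deriv_nonneg[of ?f])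
    fix x :: real assume x: "0 < x"
    have "(?f has_real_derivative x * ((3 + x\<^sup>2) * sinh x - 3 * x * cosh x)) (at x)"
      by (auto intro!: derivative_eq_intros simp: algebra_simps power2_eq_square)
    moreover have "x * ((3 + x\<^sup>2) * sinh x - 3 * x * cosh x) \<ge> 0"
      using x lower[of x] by (intro mult_nonneg_nonneg) auto
    ultimately show "\<exists>d. (?f has_real_derivative d) (at x) \<and> d \<ge> 0" by blast
  qed (use assms in \<open>auto intro!: continuous_intros\<close>)
  thus ?thesis by (simp add: tanh_def field_simps)
qed

text \<open>
  The odd series \<open>artanh T = T + T^3/3 + T^5/5 + \<dots>\<close>, with the coefficient of \<open>T^5\<close> enlarged
  to \<open>1/2\<close>. With \<open>t = T\<^sup>2\<close> the difference of the two sides has derivative \<open>t\<^sup>2 (3 - 5 t) / 2\<close>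
  in \<open>y\<close>, so the enlargement pays for the missing tail as long as \<open>t \<le> 3/5\<close>.
\<close>
lemma self_le_tanh_poly:
  assumes y: "y \<ge> 0" and T: "(tanh y)\<^sup>2 \<le> 1 / 2"
  shows "y \<le> tanh y * (1 + (tanh y)\<^sup>2 / 3 + ((tanh y)\<^sup>2)\<^sup>2 / 2 :: real)"
proof -
  let ?f = "\<lambda>y. tanh y + tanh y ^ 3 / 3 + tanh y ^ 5 / 2 - y"
  have "?f y \<ge> 0"
  proof (rule nonneg_if_deriv_nonneg[of ?f])
    fix x :: real assume x: "0 < x" "x < y"
    define t where "t = (tanh x)\<^sup>2"
    have "t \<le> (tanh y)\<^sup>2" unfolding t_def using x by (intro power_mono) auto
    hence t: "0 \<le> t" "t \<le> 1 / 2" using T by (auto simp: t_def)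
    have "(?f has_real_derivative t\<^sup>2 * (3 - 5 * t) / 2) (at x)"
      unfolding t_def
      by (auto intro!: derivative_eq_intros) (simp add: field_simps power_numeral_reduce)
    thus "\<exists>d. (?f has_real_derivative d) (at x) \<and> d \<ge> 0"
      using t by (intro exI[of _ "t\<^sup>2 * (3 - 5 * t) / 2"]) auto
  qed (use y in \<open>auto intro!: continuous_intros\<close>)
  thus ?thesis by (simp add: algebra_simps power_numeral_reduce)
qed

text \<open>
  Repeated integration of \<open>cosh \<ge> 1\<close>.
\<close>
lemma cosh_ge_taylor:
  assumes "y \<ge> 0" shows "1 + y\<^sup>2 / 2 + y ^ 4 / 24 \<le> cosh (y::real)"
proof -
  have sinh1: "y \<le> sinh y" if "y \<ge> 0" for y :: real
  proof -
    have "sinh y - y \<ge> 0"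
    proof (rule nonneg_if_deriv_nonneg[of "\<lambda>y. sinh y - y"])
      fix x :: real
      show "\<exists>d. ((\<lambda>y. sinh y - y) has_real_derivative d) (at x) \<and> d \<ge> 0"
        using cosh_real_ge_1[of x]
        by (intro exI[of _ "cosh x - 1"]) (auto intro!: derivative_eq_intros)
    qed (use that in \<open>auto intro!: continuous_intros\<close>)
    thus ?thesis by simp
  qed
  have cosh1: "1 + y\<^sup>2 / 2 \<le> cosh y" if "y \<ge> 0" for y :: real
  proof -
    have "cosh y - y\<^sup>2 / 2 - 1 \<ge> 0"
    proof (rule nonneg_if_deriv_nonneg[of "\<lambda>y. cosh y - y\<^sup>2 / 2 - 1"])
      fix x :: real assume "0 < x"
      thus "\<exists>d. ((\<lambda>y. cosh y - y\<^sup>2 / 2 - 1) has_real_derivative d) (at x) \<and> d \<ge> 0"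
        using sinh1[of x]
        by (intro exI[of _ "sinh x - x"]) (auto intro!: derivative_eq_intros)
    qed (use that in \<open>auto intro!: continuous_intros\<close>)
    thus ?thesis by simp
  qed
  have sinh2: "y + y ^ 3 / 6 \<le> sinh y" if "y \<ge> 0" for y :: real
  proof -
    have "sinh y - y ^ 3 / 6 - y \<ge> 0"
    proof (rule nonneg_if_deriv_nonneg[of "\<lambda>y. sinh y - y ^ 3 / 6 - y"])
      fix x :: real assume "0 < x"
      thus "\<exists>d. ((\<lambda>y. sinh y - y ^ 3 / 6 - y) has_real_derivative d) (at x) \<and> d \<ge> 0"
        using cosh1[of x]
        by (intro exI[of _ "cosh x - x\<^sup>2 / 2 - 1"]) (auto intro!: derivative_eq_intros)
    qed (use that in \<open>auto intro!: continuous_intros\<close>)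
    thus ?thesis by simp
  qed
  have "cosh y - y ^ 4 / 24 - y\<^sup>2 / 2 - 1 \<ge> 0"
  proof (rule nonneg_if_deriv_nonneg[of "\<lambda>y. cosh y - y ^ 4 / 24 - y\<^sup>2 / 2 - 1"])
    fix x :: real assume "0 < x"
    thus "\<exists>d. ((\<lambda>y. cosh y - y ^ 4 / 24 - y\<^sup>2 / 2 - 1) has_real_derivative d) (at x) \<and> d \<ge> 0"
      using sinh2[of x]
      by (intro exI[of _ "sinh x - x ^ 3 / 6 - x"]) (auto intro!: derivative_eq_intros)
  qed (use assms in \<open>auto intro!: continuous_intros\<close>)
  thus ?thesis by simp
qed

text \<open>
  An affine bound for \<open>y\<close> in terms of \<open>cosh y\<close>, close to a tangent line of \<open>arcosh\<close>. It
  will remove the last occurrence of \<open>y\<close> from an inequality between powers of \<open>sech y\<close>.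
\<close>
lemma self_le_cosh_affine:
  assumes "y \<ge> 0" shows "y \<le> 3 / 4 + 3 / 8 * cosh (y::real)"
proof -
  \<comment> \<open>The claim is \<open>cosh y \<ge> 8 y / 3 - 2\<close>; completing squares proves it for the Taylor polynomial.\<close>
  have "3 + y\<^sup>2 / 2 + y ^ 4 / 24 - 8 / 3 * y =
      (y\<^sup>2 - 3)\<^sup>2 / 24 + 3 / 4 * (y - 16 / 9)\<^sup>2 + (21 / 8 - 64 / 27)"
    by (simp add: power2_eq_square field_simps power4_eq_xxxx)
  also have "\<dots> \<ge> 0" by simp
  finally show ?thesis using cosh_ge_taylor[OF assms] by simp
qed

section \<open>The function \<open>y coth y - 1\<close> and its primitives\<close>

text \<open>
  At \<open>0\<close> the formula \<open>y coth y - 1\<close> is replaced by its limit, so that \<open>kap\<close> is continuous on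
  the closed half-line and has primitives \<open>Kap1\<close> and \<open>Kap2\<close> that vanish at \<open>0\<close>.
\<close>
definition kap :: "real \<Rightarrow> real" where
  "kap y = (if y = 0 then 0 else y / tanh y - 1)"

definition Kap1 :: "real \<Rightarrow> real" where
  "Kap1 y = integral {0..y} kap"

definition Kap2 :: "real \<Rightarrow> real" where
  "Kap2 y = integral {0..y} Kap1"

lemma kap_nonneg: "y \<ge> 0 \<Longrightarrow> kap y \<ge> 0"
  using tanh_le_self[of y] by (auto simp: kap_def)

lemma kap_ge: "y \<ge> 0 \<Longrightarrow> y - 1 \<le> kap y"
  using tanh_real_lt_1[of y] by (auto simp: kap_def field_simps mult_left_le)

lemma kap_le: "y \<ge> 0 \<Longrightarrow> kap y \<le> y"
  using tanh_ge_ratio[of y] by (auto simp: kap_def field_simps)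

text \<open>
  By the continued fraction, \<open>y / tanh y \<ge> (15 + 6 y\<^sup>2) / (15 + y\<^sup>2)\<close>, and the right-hand side is at
  least \<open>1 + y\<^sup>2 / 4\<close> as long as \<open>y\<^sup>2 \<le> 5\<close>.
\<close>
lemma kap_ge_square:
  assumes "0 \<le> y" "y \<le> 2" shows "y\<^sup>2 / 4 \<le> kap y"
proof (cases "y = 0")
  case False
  with assms have y: "y > 0" by simp
  have "y\<^sup>2 \<le> 2\<^sup>2" using assms by (intro power_mono) auto
  hence "0 \<le> y\<^sup>2 * (5 - y\<^sup>2)" by auto
  hence "(1 + y\<^sup>2 / 4) * (15 + y\<^sup>2) \<le> 15 + 6 * y\<^sup>2"
    by (simp add: algebra_simps)
  hence "(1 + y\<^sup>2 / 4) * (15 + y\<^sup>2) * tanh y \<le> (15 + 6 * y\<^sup>2) * tanh y"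
    using y by (intro mult_right_mono) auto
  also have "\<dots> \<le> y * (15 + y\<^sup>2)" using tanh_continued_fraction y by simp
  finally have "(15 + y\<^sup>2) * ((1 + y\<^sup>2 / 4) * tanh y) \<le> (15 + y\<^sup>2) * y" by (simp add: mult_ac)
  hence "(1 + y\<^sup>2 / 4) * tanh y \<le> y"
    by (rule mult_left_le_imp_le) (simp add: add_pos_nonneg)
  thus ?thesis using y by (simp add: kap_def field_simps)
qed (simp add: kap_def)

lemma continuous_on_kap: "continuous_on {0..} kap"
proof -
  have "continuous (at y within {0..}) kap" if y: "y \<ge> 0" for y
  proof (cases "y = 0")
    case True
    have "(kap \<longlongrightarrow> 0) (at 0 within {0..})"
    proof (rule tendsto_sandwich)
      show "eventually (\<lambda>y. 0 \<le> kap y) (at 0 within {0..})"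
        by (auto simp: eventually_at_filter kap_nonneg intro!: always_eventually)
      show "eventually (\<lambda>y. kap y \<le> y) (at 0 within {0..})"
        by (auto simp: eventually_at_filter kap_le intro!: always_eventually)
    qed (auto intro!: tendsto_eq_intros)
    thus ?thesis using True by (simp add: continuous_within kap_def)
  next
    case False
    have "isCont (\<lambda>y. y / tanh y - 1) y"
      using False by (auto intro!: continuous_intros)
    moreover have "eventually (\<lambda>z. z / tanh z - 1 = kap z) (nhds y)"
      using t1_space_nhds[OF False] by eventually_elim (simp add: kap_def)
    ultimately have "isCont kap y" by (simp cong: isCont_cong)
    thus ?thesis by (rule continuous_at_imp_continuous_at_within)
  qed
  thus ?thesis by (simp add: continuous_on_eq_continuous_within)
qed

lemma primitive_derivs:
  fixes f :: "real \<Rightarrow> real"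
  assumes "continuous_on {0..} f"
  shows "y > 0 \<Longrightarrow> ((\<lambda>y. integral {0..y} f) has_real_derivative f y) (at y)"
    and "continuous_on {0..} (\<lambda>y. integral {0..y} f)"
proof -
  have D: "((\<lambda>y. integral {0..y} f) has_real_derivative f y) (at y within {0..b})"
    if "0 \<le> y" "y \<le> b" for y b
    by (rule integral_has_real_derivative) (use that assms in \<open>auto intro: continuous_on_subset\<close>)
  show "((\<lambda>y. integral {0..y} f) has_real_derivative f y) (at y)" if "y > 0"
    using D[of y "y + 1"] that at_within_Icc_at[of 0 y "y + 1"] by simp
  have "continuous (at y within {0..}) (\<lambda>y. integral {0..y} f)" if "y \<ge> 0" for y
  proof -
    have "continuous (at y within {0..y+1}) (\<lambda>y. integral {0..y} f)"
      by (rule DERIV_continuous[OF D]) (use that in auto)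
    moreover have "at y within {0..} = at y within {0..y+1}"
      by (rule at_within_nhd[of _ "{y - 1<..<y + 1}"]) (auto)
    ultimately show ?thesis by simp
  qed
  thus "continuous_on {0..} (\<lambda>y. integral {0..y} f)"
    by (simp add: continuous_on_eq_continuous_within)
qed

lemma continuous_on_Kap1: "continuous_on {0..} Kap1"
  and Kap1_deriv: "y > 0 \<Longrightarrow> (Kap1 has_real_derivative kap y) (at y)"
  using primitive_derivs[OF continuous_on_kap] by (auto simp: Kap1_def[abs_def])

lemma continuous_on_Kap2: "continuous_on {0..} Kap2"
  and Kap2_deriv: "y > 0 \<Longrightarrow> (Kap2 has_real_derivative Kap1 y) (at y)"
  using primitive_derivs[OF continuous_on_Kap1] by (auto simp: Kap2_def[abs_def])

lemma Kap_0 [simp]: "Kap1 0 = 0" "Kap2 0 = 0"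
  by (simp_all add: Kap1_def Kap2_def)

lemma Kap1_nonneg: "y \<ge> 0 \<Longrightarrow> Kap1 y \<ge> 0"
  by (rule nonneg_if_deriv_nonneg[of Kap1])
     (auto intro!: Kap1_deriv kap_nonneg exI conjI continuous_on_subset[OF continuous_on_Kap1])

lemma Kap2_nonneg: "y \<ge> 0 \<Longrightarrow> Kap2 y \<ge> 0"
  by (rule nonneg_if_deriv_nonneg[of Kap2])
     (auto intro!: Kap2_deriv Kap1_nonneg exI conjI continuous_on_subset[OF continuous_on_Kap2])

lemma Kap1_le:
  assumes "y \<ge> 0" shows "Kap1 y \<le> y\<^sup>2 / 2"
proof -
  have "y\<^sup>2 / 2 - Kap1 y \<ge> 0"
    by (rule nonneg_if_deriv_nonneg[of "\<lambda>y. y\<^sup>2 / 2 - Kap1 y"])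
       (use assms in \<open>auto intro!: derivative_eq_intros Kap1_deriv kap_le exI conjI
          continuous_intros continuous_on_subset[OF continuous_on_Kap1]\<close>)
  thus ?thesis by simp
qed

lemma Kap2_le:
  assumes "y \<ge> 0" shows "Kap2 y \<le> y ^ 3 / 6"
proof -
  have "y ^ 3 / 6 - Kap2 y \<ge> 0"
  proof (rule nonneg_if_deriv_nonneg[of "\<lambda>y. y ^ 3 / 6 - Kap2 y"])
    show "\<exists>d. ((\<lambda>y. y ^ 3 / 6 - Kap2 y) has_real_derivative d) (at x) \<and> d \<ge> 0" if "0 < x" for x
      using that Kap1_le[of x]
      by (intro exI[of _ "x\<^sup>2 / 2 - Kap1 x"]) (auto intro!: derivative_eq_intros Kap2_deriv)
  qed (use assms in \<open>auto intro!: continuous_intros continuous_on_subset[OF continuous_on_Kap2]\<close>)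
  thus ?thesis by simp
qed

text \<open>
  Integrating \<open>y\<^sup>2 / 4\<close> up to \<open>2\<close> and \<open>y - 1\<close> from there on gives
  \<open>Kap1 y \<ge> y\<^sup>2 / 2 - y + 2 / 3\<close> for \<open>y \<ge> 2\<close>. The line \<open>2 y - 23 / 6\<close> is the tangent of this
  parabola at \<open>3\<close>. The slope \<open>2\<close> is chosen so that, in \<open>slope_numerator_nonneg\<close>, the terms
  linear in \<open>y\<close> cancel as \<open>tanh y\<close> tends to \<open>1\<close>; the critical point of the resulting estimate
  then lies near \<open>y = 3\<close>.
\<close>
lemma Kap1_ge:
  assumes y: "y \<ge> 0" shows "2 * y - 23 / 6 \<le> Kap1 y"
proof -
  have cube: "y ^ 3 / 12 \<le> Kap1 y" if "0 \<le> y" "y \<le> 2" for y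
  proof -
    have "Kap1 y - y ^ 3 / 12 \<ge> 0"
    proof (rule nonneg_if_deriv_nonneg[of "\<lambda>y. Kap1 y - y ^ 3 / 12"])
      show "\<exists>d. ((\<lambda>y. Kap1 y - y ^ 3 / 12) has_real_derivative d) (at x) \<and> d \<ge> 0"
        if "0 < x" "x < y" for x
        using that \<open>y \<le> 2\<close> kap_ge_square[of x]
        by (intro exI[of _ "kap x - x\<^sup>2 / 4"]) (auto intro!: derivative_eq_intros Kap1_deriv)
    qed (use that in \<open>auto intro!: continuous_intros continuous_on_subset[OF continuous_on_Kap1]\<close>)
    thus ?thesis by simp
  qed
  show ?thesis
  proof (cases "y \<le> 2")
    case True
    have "y ^ 3 / 12 - 2 * y + 23 / 6 = (2 - y) * (2 - y\<^sup>2 / 12 - y / 6 - 1/3) + 1 / 2"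
      by (simp add: power2_eq_square power3_eq_cube field_simps)
    moreover have "y\<^sup>2 \<le> 2\<^sup>2" using y True by (intro power_mono) auto
    hence "(2 - y) * (2 - y\<^sup>2 / 12 - y / 6 - 1/3) \<ge> 0"
      using True by (intro mult_nonneg_nonneg) auto
    ultimately show ?thesis using cube[OF y True] by linarith
  next
    case False
    let ?g = "\<lambda>y. Kap1 y - (y\<^sup>2 / 2 - y + 2 / 3)"
    have "?g 2 \<le> ?g y"
    proof (rule DERIV_nonneg_imp_increasing_open[of 2 y ?g])
      show "\<exists>d. (?g has_real_derivative d) (at x) \<and> d \<ge> 0" if "2 < x" "x < y" for x
        using that kap_ge[of x]
        by (intro exI[of _ "kap x - (x - 1)"])
           (auto intro!: derivative_eq_intros Kap1_deriv)
    qed (use False in \<open>auto intro!: continuous_intros continuous_on_subset[OF continuous_on_Kap1]\<close>)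
    moreover have "?g 2 \<ge> 0" using cube[of 2] by simp
    moreover have "(y - 3)\<^sup>2 \<ge> 0" by simp
    ultimately show ?thesis by (simp add: power2_eq_square algebra_simps)
  qed
qed

section \<open>The sign of the fourth derivative of the kernel\<close>

text \<open>
  Up to the factor \<open>120\<close> this is the polynomial in \<open>w = sech y\<close> to which the slope estimate
  reduces for \<open>tanh y ^ 2 \<ge> 1 / 2\<close>. It is small but positive near \<open>w = 3/20\<close>, where the quadratic
  part decides; beyond \<open>1 / 2\<close> one expands around \<open>1 / 2\<close>.
\<close>
lemma sech_polynomial_nonneg:
  fixes w :: real
  assumes "0 \<le> w" "w \<le> 5 / 7"
  shows "0 \<le> 80 - 675 * w + 2230 * w ^ 2 + 945 * w ^ 3 - 4790 * w ^ 4 - 594 * w ^ 5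
            + 2444 * w ^ 6 - 288 * w ^ 8" (is "0 \<le> ?P w")
proof (cases "w \<le> 1 / 2")
  case True
  have pw: "w ^ 2 \<le> w / 2" "w ^ 3 \<le> w / 4"
    using mult_mono[OF True order_refl, of w] mult_mono[OF True True] mult_mono[of "w * w" "1/4" w w] assms True
    by (auto simp: power2_eq_square power3_eq_cube)
  have le1: "w ^ 2 \<le> 1" using power_le_one[of w 2] assms by simp
  have eq: "?P w = (80 - 675 * w + 1424 * w\<^sup>2)
      + w\<^sup>2 * ((806 + 945 * w - 4790 * w ^ 2 - 594 * w ^ 3) + w ^ 4 * (2444 - 288 * w\<^sup>2))"
    by (simp add: algebra_simps power_numeral_reduce)
  \<comment> \<open>\<open>1424\<close> is the least integer that makes the discriminant of this quadratic negative.\<close>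
  have "80 - 675 * w + 1424 * w\<^sup>2 = 1424 * (w - 675 / 2848)\<^sup>2 + (80 - 675\<^sup>2 / 5696)"
    by (simp add: power2_eq_square field_simps)
  also have "\<dots> \<ge> 0" by (simp add: power2_eq_square)
  finally have quadratic: "80 - 675 * w + 1424 * w\<^sup>2 \<ge> 0" .
  have "806 + 945 * w - 4790 * w ^ 2 - 594 * w ^ 3 \<ge> 0"
    using pw True by linarith
  moreover have "w ^ 4 * (2444 - 288 * w\<^sup>2) \<ge> 0"
    using le1 by (intro mult_nonneg_nonneg) auto
  ultimately show ?thesis
    unfolding eq by (intro add_nonneg_nonneg[OF quadratic] mult_nonneg_nonneg[OF zero_le_power2] add_nonneg_nonneg)
next
  case False
  define z where "z = w - 1 / 2"
  have z: "0 \<le> z" "z \<le> 3 / 14" using False assms by (auto simp: z_def)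
  have pz: "z ^ 2 \<le> 3 / 14 * z" "z ^ 3 \<le> 9 / 196 * z"
    using mult_right_mono[OF z(2) z(1)] mult_right_mono[OF mult_mono[OF z(2) z(2)] z(1)] z
    by (auto simp: power2_eq_square power3_eq_cube)
  have le1: "z ^ 3 \<le> 1" "z ^ 4 \<le> 1" using z by (auto intro!: power_le_one)
  have "?P w = (549/4 + 987/8 * z - 8459/4 * z ^ 2 - 4514 * z ^ 3)
      + z ^ 4 * (1630 + 4722 * z + 428 * z\<^sup>2 - 1152 * z ^ 3 - 288 * z ^ 4)"
    unfolding z_def by (simp add: field_simps power_numeral_reduce)
  moreover have "549/4 + 987/8 * z - 8459/4 * z ^ 2 - 4514 * z ^ 3 \<ge> 0"
    using pz z by linarith
  moreover have "1630 + 4722 * z + 428 * z\<^sup>2 - 1152 * z ^ 3 - 288 * z ^ 4 \<ge> 0"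
    using le1 z zero_le_power[OF z(1), of 2] by linarith
  ultimately show ?thesis using z by simp
qed

text \<open>
  The expression is \<open>4 (3 - 2 T\<^sup>2)\<^sup>2\<close> times the derivative of \<open>q4_core\<close> below. The sign of the
  coefficient of \<open>Kap1\<close> changes at \<open>\<tau> = 1 / 2\<close>, hence two cases. The bracketed group comes from the
  summand \<open>1\<close> of the factor \<open>1 + coth\<close> and is nonnegative by itself; it may be dropped in the
  first case but contributes to the second.

  For \<open>\<tau> \<le> 1 / 2\<close> the crude bound \<open>Kap1 y \<le> y\<^sup>2 / 2 \<le> y / 2\<close> suffices; substituting
  \<open>y \<le> T (1 + \<tau> / 3 + \<tau>\<^sup>2 / 2)\<close> leaves a polynomial in \<open>\<tau>\<close> whose lowest two coefficients vanish.

  For \<open>\<tau> \<ge> 1 / 2\<close> the bound \<open>Kap1 y \<ge> 2 y - 23 / 6\<close> makes the total coefficient of \<open>y\<close> equal to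
  \<open>- (1 - \<tau>) (9 + 12 \<tau>\<^sup>2 - 6 T)\<close>. Since \<open>1 - \<tau> = w\<^sup>2\<close> with \<open>w = sech y\<close>, the affine bound for \<open>y\<close>
  in terms of \<open>1 / w\<close> eliminates \<open>y\<close>, and a polynomial lower bound for \<open>T = sqrt (1 - w\<^sup>2)\<close> leaves
  a polynomial in \<open>w\<close>.
\<close>
lemma slope_numerator_nonneg:
  assumes y: "y > 0"
  defines "T \<equiv> tanh y" and "\<tau> \<equiv> (tanh y)\<^sup>2"
  shows "0 \<le> T * (9 - 6 * \<tau> + 12 * \<tau>\<^sup>2) - y * (9 - 9 * \<tau> + 4 * \<tau>\<^sup>2 + 4 * \<tau> ^ 3)
     + (6 * T * (1 - \<tau>) * (y - T) + 3 * \<tau>\<^sup>2 - 2 * \<tau> ^ 3) + 4 * \<tau>\<^sup>2 * (2 * \<tau> - 1) * Kap1 y"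
proof -
  have T: "0 < T" "T < 1" "T \<le> y" using y tanh_real_lt_1[of y] tanh_le_self[of y] by (auto simp: T_def)
  have \<tau>: "0 < \<tau>" "\<tau> < 1" "\<tau> = T\<^sup>2" using T tanh_square_less_one[of y] by (auto simp: \<tau>_def T_def)
  show ?thesis
  proof (cases "\<tau> \<le> 1 / 2")
    case True
    let ?c = "1 + \<tau> / 3 + \<tau>\<^sup>2 / 2"
    have yT: "y \<le> T * ?c"
      using self_le_tanh_poly[of y] y True by (simp add: T_def \<tau>_def)
    \<comment> \<open>\<open>5 / 7\<close> is a rational upper bound for \<open>1 / sqrt 2\<close>.\<close>
    have "T\<^sup>2 \<le> (5 / 7)\<^sup>2" using True \<tau> by (simp add: power2_eq_square)
    hence "T \<le> 5 / 7" by (rule power2_le_imp_le) simp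
    moreover have "\<tau>\<^sup>2 \<le> (1 / 2)\<^sup>2" using True \<tau> by (intro power_mono) auto
    hence "?c \<le> 31 / 24" using True by (simp add: power2_eq_square)
    ultimately have "T * ?c \<le> 5 / 7 * (31 / 24)" using T \<tau> by (intro mult_mono) auto
    hence y1: "y \<le> 1" using yT by simp
    have "Kap1 y \<le> y\<^sup>2 / 2" using Kap1_le y by simp
    also have "\<dots> \<le> y / 2" using y y1 by (simp add: power2_eq_square mult_left_le)
    finally have "(4 * \<tau>\<^sup>2 * (1 - 2 * \<tau>)) * Kap1 y \<le> (4 * \<tau>\<^sup>2 * (1 - 2 * \<tau>)) * (y / 2)"
      using True \<tau> by (intro mult_left_mono) auto
    moreover have "y * (9 - 9 * \<tau> + 6 * \<tau>\<^sup>2) \<le> (T * ?c) * (9 - 9 * \<tau> + 6 * \<tau>\<^sup>2)"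
      using True by (intro mult_right_mono yT) auto
    moreover have "T * (9 - 6 * \<tau> + 12 * \<tau>\<^sup>2) - (T * ?c) * (9 - 9 * \<tau> + 6 * \<tau>\<^sup>2) =
        T * \<tau>\<^sup>2 * (9 / 2 + 5 / 2 * \<tau> - 3 * \<tau>\<^sup>2)"
      by (simp add: field_simps power_numeral_reduce)
    moreover have "T * \<tau>\<^sup>2 * (9 / 2 + 5 / 2 * \<tau> - 3 * \<tau>\<^sup>2) \<ge> 0"
    proof -
      have "9 / 2 + 5 / 2 * \<tau> - 3 * \<tau>\<^sup>2 \<ge> 0"
        using \<tau>(1) \<open>\<tau>\<^sup>2 \<le> (1 / 2)\<^sup>2\<close> by (simp add: power2_eq_square)
      thus ?thesis using T by (intro mult_nonneg_nonneg) auto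
    qed
    moreover have "6 * T * (1 - \<tau>) * (y - T) \<ge> 0" using T \<tau> by auto
    moreover have "3 * \<tau>\<^sup>2 - 2 * \<tau> ^ 3 = \<tau>\<^sup>2 * (3 - 2 * \<tau>)"
      by (simp add: algebra_simps power_numeral_reduce)
    hence "3 * \<tau>\<^sup>2 - 2 * \<tau> ^ 3 \<ge> 0" using \<tau> by simp
    ultimately show ?thesis
      by (simp add: algebra_simps power_numeral_reduce)
  next
    case False
    define w where "w = 1 / cosh y"
    have w: "w > 0" by (simp add: w_def)
    have w2: "w\<^sup>2 = 1 - \<tau>"
    proof -
      have "1 - \<tau> = ((cosh y)\<^sup>2 - (sinh y)\<^sup>2) / (cosh y)\<^sup>2"
        by (simp add: \<tau>_def tanh_def power_divide diff_divide_distrib)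
      also have "(cosh y)\<^sup>2 - (sinh y)\<^sup>2 = 1" by (simp add: cosh_square_eq)
      finally show ?thesis by (simp add: w_def power_divide)
    qed
    have "w\<^sup>2 \<le> (5 / 7)\<^sup>2" using False w2 by (simp add: power2_eq_square)
    hence w57: "w \<le> 5 / 7" by (rule power2_le_imp_le) simp
    \<comment> \<open>Near \<open>w = 0\<close> the root \<open>sqrt (1 - w\<^sup>2)\<close> is \<open>1 - w\<^sup>2 / 2 - w ^ 4 / 8 - \<dots>\<close>; the constant \<open>1 / 5\<close> in place of
      \<open>1 / 8\<close> covers the tail for \<open>w\<^sup>2 \<le> 1 / 2\<close>.\<close>
    define T' where "T' = 1 - w\<^sup>2 / 2 - (w\<^sup>2)\<^sup>2 / 5"
    have half: "w\<^sup>2 \<le> 1 / 2" using False w2 by simp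
    have T': "T' \<le> T"
    proof (rule power2_le_imp_le)
      have "(w\<^sup>2) ^ 2 \<le> (1 / 2) ^ 2" by (intro power_mono half) auto
      hence "(w\<^sup>2)\<^sup>2 * (3 / 20 - w\<^sup>2 / 5 - (w\<^sup>2)\<^sup>2 / 25) \<ge> 0"
        using half by (intro mult_nonneg_nonneg) (auto simp: power2_eq_square)
      moreover have "T\<^sup>2 - T'\<^sup>2 = (w\<^sup>2)\<^sup>2 * (3 / 20 - w\<^sup>2 / 5 - (w\<^sup>2)\<^sup>2 / 25)"
        using w2 unfolding T'_def \<tau>(3)[symmetric] by (simp add: field_simps power2_eq_square)
      ultimately show "T'\<^sup>2 \<le> T\<^sup>2" by simp
    qed (use T in auto)
    have "y * w \<le> (3 / 4 + 3 / 8 * cosh y) * w"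
      using self_le_cosh_affine[of y] y w by (intro mult_right_mono) auto
    also have "\<dots> = 3 / 4 * w + 3 / 8" by (simp add: w_def field_simps)
    finally have "y * w * w \<le> (3 / 4 * w + 3 / 8) * w"
      using w by (intro mult_right_mono) auto
    hence yw: "y * (1 - \<tau>) \<le> 3 / 4 * w\<^sup>2 + 3 / 8 * w"
      unfolding w2[symmetric] by (simp add: power2_eq_square algebra_simps)
    have "9 + 12 * \<tau>\<^sup>2 - 6 * T \<ge> 0" using T \<tau> by (simp add: add_increasing2 add_nonneg_nonneg)
    hence "y * (1 - \<tau>) * (9 + 12 * \<tau>\<^sup>2 - 6 * T) \<le>
        (3 / 4 * w\<^sup>2 + 3 / 8 * w) * (9 + 12 * \<tau>\<^sup>2 - 6 * T)"
      by (rule mult_right_mono[OF yw])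
    moreover have "(4 * \<tau>\<^sup>2 * (2 * \<tau> - 1)) * (2 * y - 23 / 6) \<le> (4 * \<tau>\<^sup>2 * (2 * \<tau> - 1)) * Kap1 y"
      using False Kap1_ge[of y] y by (intro mult_left_mono) auto
    moreover have "T' * (9 - 6 * \<tau> + 12 * \<tau>\<^sup>2 + 6 * (3 / 4 * w\<^sup>2 + 3 / 8 * w)) \<le>
        T * (9 - 6 * \<tau> + 12 * \<tau>\<^sup>2 + 6 * (3 / 4 * w\<^sup>2 + 3 / 8 * w))"
      using \<tau> w by (intro mult_right_mono T') (auto simp: add_nonneg_nonneg)
    moreover have "120 * (T' * (9 - 6 * \<tau> + 12 * \<tau>\<^sup>2 + 6 * (3 / 4 * w\<^sup>2 + 3 / 8 * w))
        - (3 / 4 * w\<^sup>2 + 3 / 8 * w) * (9 + 12 * \<tau>\<^sup>2)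
        + (9 * \<tau>\<^sup>2 - 6 * \<tau> - 2 * \<tau> ^ 3) - 46 / 3 * \<tau>\<^sup>2 * (2 * \<tau> - 1)) =
      80 - 675 * w + 2230 * w ^ 2 + 945 * w ^ 3 - 4790 * w ^ 4 - 594 * w ^ 5
            + 2444 * w ^ 6 - 288 * w ^ 8"
    proof -
      have "\<tau> = 1 - w\<^sup>2" using w2 by simp
      show ?thesis unfolding T'_def \<open>\<tau> = 1 - w\<^sup>2\<close>
        by (simp add: field_simps power_numeral_reduce)
    qed
    moreover note sech_polynomial_nonneg[OF less_imp_le[OF w] w57]
    moreover have "T * (9 - 6 * \<tau> + 12 * \<tau>\<^sup>2) - y * (9 - 9 * \<tau> + 4 * \<tau>\<^sup>2 + 4 * \<tau> ^ 3)
     + (6 * T * (1 - \<tau>) * (y - T) + 3 * \<tau>\<^sup>2 - 2 * \<tau> ^ 3) + 4 * \<tau>\<^sup>2 * (2 * \<tau> - 1) * (2 * y - 23 / 6) =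
       T * (9 - 6 * \<tau> + 12 * \<tau>\<^sup>2) - y * (1 - \<tau>) * (9 + 12 * \<tau>\<^sup>2 - 6 * T)
        + (9 * \<tau>\<^sup>2 - 6 * \<tau> - 2 * \<tau> ^ 3) - 46 / 3 * \<tau>\<^sup>2 * (2 * \<tau> - 1)"
      unfolding \<tau>(3) by (simp add: field_simps power_numeral_reduce)
    moreover have "(3 / 4 * w\<^sup>2 + 3 / 8 * w) * (9 + 12 * \<tau>\<^sup>2 - 6 * T) =
       (3 / 4 * w\<^sup>2 + 3 / 8 * w) * (9 + 12 * \<tau>\<^sup>2) - T * (6 * (3 / 4 * w\<^sup>2 + 3 / 8 * w))"
      by (simp add: algebra_simps)
    moreover have "T * (9 - 6 * \<tau> + 12 * \<tau>\<^sup>2 + 6 * (3 / 4 * w\<^sup>2 + 3 / 8 * w)) =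
       T * (9 - 6 * \<tau> + 12 * \<tau>\<^sup>2) + T * (6 * (3 / 4 * w\<^sup>2 + 3 / 8 * w))"
      by (simp only: distrib_left)
    ultimately show ?thesis by argo
  qed
qed

text \<open>
  The fourth derivative of \<open>q0\<close> (defined below) is a linear combination of \<open>Kap2\<close>, \<open>Kap1\<close> and an
  elementary function. This is that combination, divided by the coefficient of \<open>Kap2\<close>: after the
  division one differentiation removes \<open>Kap2\<close>.
\<close>
definition q4_core :: "real \<Rightarrow> real" where
  "q4_core y = Kap2 y - tanh y * (3 - (tanh y)\<^sup>2) / (3 - 2 * (tanh y)\<^sup>2) * Kap1 y
     + tanh y * (9 * (y - tanh y) - 2 * y * (tanh y)\<^sup>2 + tanh y * (y - tanh y))
         / (4 * (3 - 2 * (tanh y)\<^sup>2))"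

lemma continuous_on_q4_core: "continuous_on {0..} q4_core"
proof -
  have "3 - 2 * (tanh x)\<^sup>2 > 0" for x :: real using tanh_square_less_one[of x] by simp
  hence "2 * (tanh x)\<^sup>2 \<noteq> 3" for x :: real by (metis diff_gt_0_iff_gt less_irrefl)
  thus ?thesis
    unfolding q4_core_def[abs_def]
    by (auto intro!: continuous_intros continuous_on_Kap1 continuous_on_Kap2)
qed

text \<open>
  The function vanishes at \<open>0\<close> and its derivative has the numerator treated above.
\<close>
lemma q4_core_nonneg:
  assumes "y \<ge> 0" shows "q4_core y \<ge> 0"
proof (rule nonneg_if_deriv_nonneg[of q4_core])
  have pos: "3 - 2 * (tanh x)\<^sup>2 > 0" for x :: real using tanh_square_less_one[of x] by simp
  have ne: "3 - 2 * (tanh x)\<^sup>2 \<noteq> 0" for x :: real using pos[of x] by simp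
  show "continuous_on {0..y} q4_core"
    by (rule continuous_on_subset[OF continuous_on_q4_core]) auto
  fix x :: real assume x: "0 < x" "x < y"
  define N where "N = tanh x * (9 - 6 * (tanh x)\<^sup>2 + 12 * ((tanh x)\<^sup>2)\<^sup>2)
     - x * (9 - 9 * (tanh x)\<^sup>2 + 4 * ((tanh x)\<^sup>2)\<^sup>2 + 4 * ((tanh x)\<^sup>2) ^ 3)
     + (6 * tanh x * (1 - (tanh x)\<^sup>2) * (x - tanh x) + 3 * ((tanh x)\<^sup>2)\<^sup>2 - 2 * ((tanh x)\<^sup>2) ^ 3)
     + 4 * ((tanh x)\<^sup>2)\<^sup>2 * (2 * (tanh x)\<^sup>2 - 1) * Kap1 x"
  have T0: "tanh x \<noteq> 0" using x by simp
  have kx: "kap x = x / tanh x - 1" using x by (simp add: kap_def)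
  define T where "T = tanh x"
  let ?D = "3 - 2 * T\<^sup>2"
  \<comment> \<open>Write \<open>q4_core = Kap2 - R * Kap1 + W\<close> with \<open>R\<close> and \<open>W\<close> elementary. The derivative of
    \<open>W\<close> is written so that its second summand cancels the term \<open>R * kap x\<close> of \<open>(R * Kap1)'\<close>.\<close>
  let ?N0 = "N - 4 * (T\<^sup>2)\<^sup>2 * (2 * T\<^sup>2 - 1) * Kap1 x"
  have D: "?D \<noteq> 0" unfolding T_def by (rule ne)
  have D': "2 * T\<^sup>2 \<noteq> 3" using D by linarith
  have R: "((\<lambda>x. tanh x * (3 - (tanh x)\<^sup>2) / (3 - 2 * (tanh x)\<^sup>2)) has_real_derivative
             1 - (T\<^sup>2)\<^sup>2 * (2 * T\<^sup>2 - 1) / ?D\<^sup>2) (at x)"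
    using D D' unfolding T_def
    by (auto intro!: derivative_eq_intros)
       (simp add: divide_simps, simp add: algebra_simps power_numeral_reduce)
  have W: "((\<lambda>x. tanh x * (9 * (x - tanh x) - 2 * x * (tanh x)\<^sup>2 + tanh x * (x - tanh x))
         / (4 * (3 - 2 * (tanh x)\<^sup>2))) has_real_derivative
             ?N0 / (4 * ?D\<^sup>2) + (3 - T\<^sup>2) * (x - T) / ?D) (at x)"
    using D D' unfolding T_def N_def
    by (auto intro!: derivative_eq_intros)
       (simp add: divide_simps, simp add: algebra_simps power_numeral_reduce)
  have "(q4_core has_real_derivative Kap1 x - ((1 - (T\<^sup>2)\<^sup>2 * (2 * T\<^sup>2 - 1) / ?D\<^sup>2) * Kap1 x
          + kap x * (T * (3 - T\<^sup>2) / ?D)) + (?N0 / (4 * ?D\<^sup>2) + (3 - T\<^sup>2) * (x - T) / ?D)) (at x)"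
    unfolding q4_core_def[abs_def] T_def
    by (intro DERIV_add DERIV_diff DERIV_mult Kap2_deriv Kap1_deriv R[unfolded T_def] W[unfolded T_def] x)
  also have "Kap1 x - ((1 - (T\<^sup>2)\<^sup>2 * (2 * T\<^sup>2 - 1) / ?D\<^sup>2) * Kap1 x
          + kap x * (T * (3 - T\<^sup>2) / ?D)) + (?N0 / (4 * ?D\<^sup>2) + (3 - T\<^sup>2) * (x - T) / ?D) =
          N / (4 * ?D\<^sup>2)"
  proof -
    have A: "kap x * (T * (3 - T\<^sup>2) / ?D) = (3 - T\<^sup>2) * (x - T) / ?D"
    proof -
      have "kap x * T = x - T" using T0 by (simp add: kx T_def field_simps)
      thus ?thesis by (simp add: mult_ac flip: mult.assoc)
    qed
    have B: "?N0 / (4 * ?D\<^sup>2) = N / (4 * ?D\<^sup>2) - (T\<^sup>2)\<^sup>2 * (2 * T\<^sup>2 - 1) / ?D\<^sup>2 * Kap1 x"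
      by (simp add: diff_divide_distrib)
    show ?thesis unfolding A B by (simp add: left_diff_distrib)
  qed
  finally have "(q4_core has_real_derivative N / (4 * (3 - 2 * (tanh x)\<^sup>2)\<^sup>2)) (at x)"
    by (simp only: T_def)
  moreover have "N \<ge> 0" unfolding N_def using slope_numerator_nonneg[OF x(1)] .
  ultimately show "\<exists>d. (q4_core has_real_derivative d) (at x) \<and> d \<ge> 0"
    using pos[of x] by (intro exI[of _ "N / (4 * (3 - 2 * (tanh x)\<^sup>2)\<^sup>2)"]) auto
qed (use assms in \<open>auto simp: q4_core_def\<close>)

section \<open>The kernel and its boundary behaviour\<close>

definition coth :: "real \<Rightarrow> real" where "coth y = 1 / tanh y"

lemma coth_deriv: "y \<noteq> 0 \<Longrightarrow> (coth has_real_derivative 1 - (coth y)\<^sup>2) (at y)"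
  unfolding coth_def[abs_def]
  by (auto intro!: derivative_eq_intros simp: field_simps power2_eq_square)

lemma kap_eq: "y \<noteq> 0 \<Longrightarrow> kap y = y * coth y - 1"
  by (simp add: kap_def coth_def)

lemma kap_deriv:
  assumes "y > 0"
  shows "(kap has_real_derivative coth y + y * (1 - (coth y)\<^sup>2)) (at y)"
proof (rule has_field_derivative_transform_within_open[where S = "{0<..}"])
  show "((\<lambda>y. y * coth y - 1) has_real_derivative coth y + y * (1 - (coth y)\<^sup>2)) (at y)"
    using assms by (auto intro!: derivative_eq_intros coth_deriv)
qed (use assms in \<open>auto simp: kap_eq\<close>)

text \<open>
  The kernel \<open>q0\<close> and its derivatives \<open>q1\<close>, \<open>\<dots>\<close>, \<open>q4\<close>. The last one is given in the factored
  form that shows its sign.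
\<close>
definition q0 :: "real \<Rightarrow> real" where
  "q0 y = Kap2 y * (1 + coth y)"
definition q1 :: "real \<Rightarrow> real" where
  "q1 y = Kap1 y * (1 + coth y) + Kap2 y * (1 - (coth y)\<^sup>2)"
definition q2 :: "real \<Rightarrow> real" where
  "q2 y = kap y * (1 + coth y) + 2 * Kap1 y * (1 - (coth y)\<^sup>2)
     - 2 * Kap2 y * coth y * (1 - (coth y)\<^sup>2)"
definition q3 :: "real \<Rightarrow> real" where
  "q3 y = (coth y + y * (1 - (coth y)\<^sup>2)) * (1 + coth y) + 3 * kap y * (1 - (coth y)\<^sup>2)
     - 6 * Kap1 y * coth y * (1 - (coth y)\<^sup>2)
     - 2 * Kap2 y * (1 - (coth y)\<^sup>2) * (1 - 3 * (coth y)\<^sup>2)"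
definition q4 :: "real \<Rightarrow> real" where
  "q4 y = 8 * (1 - (tanh y)\<^sup>2) * (3 - 2 * (tanh y)\<^sup>2) / tanh y ^ 5 * q4_core y"

lemma q4_nonneg: "y > 0 \<Longrightarrow> q4 y \<ge> 0"
  using tanh_square_less_one[of y] q4_core_nonneg[of y]
  unfolding q4_def by (intro mult_nonneg_nonneg divide_nonneg_nonneg) auto

lemma q_derivs:
  assumes y: "y > 0"
  shows "(q0 has_real_derivative q1 y) (at y)" "(q1 has_real_derivative q2 y) (at y)"
    "(q2 has_real_derivative q3 y) (at y)" "(q3 has_real_derivative q4 y) (at y)"
proof -
  note D = Kap2_deriv[OF y] Kap1_deriv[OF y] kap_deriv[OF y] coth_deriv[of y]
  show "(q0 has_real_derivative q1 y) (at y)"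
    unfolding q0_def[abs_def] q1_def using y
    by (auto intro!: derivative_eq_intros D)
  show "(q1 has_real_derivative q2 y) (at y)"
    unfolding q1_def[abs_def] q2_def using y
    by (auto intro!: derivative_eq_intros D)
  show "(q2 has_real_derivative q3 y) (at y)"
    unfolding q2_def[abs_def] q3_def using y
    by (auto intro!: derivative_eq_intros D) (simp add: algebra_simps power_numeral_reduce)
  let ?c = "coth y"
  \<comment> \<open>The derivative of \<open>q3\<close> by the product rule, as a polynomial in \<open>coth y\<close>; it remains to factor it.\<close>
  let ?d = "2 * (1 - ?c\<^sup>2) * (1 - y * ?c) * (1 + ?c) + 4 * (?c + y * (1 - ?c\<^sup>2)) * (1 - ?c\<^sup>2)
     - 12 * kap y * ?c * (1 - ?c\<^sup>2) - 8 * Kap1 y * (1 - ?c\<^sup>2) * (1 - 3 * ?c\<^sup>2)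
     + 8 * Kap2 y * ?c * (1 - ?c\<^sup>2) * (2 - 3 * ?c\<^sup>2)"
  have "(q3 has_real_derivative ?d) (at y)"
    unfolding q3_def[abs_def] using y
    by (auto intro!: derivative_eq_intros D) (simp add: algebra_simps power_numeral_reduce)
  moreover have "?d = q4 y"
  proof -
    have T: "tanh y \<noteq> 0" using y by simp
    have ne: "3 - 2 * (tanh y)\<^sup>2 \<noteq> 0" using tanh_square_less_one[of y] by simp
    define T where "T = tanh y"
    have T': "T \<noteq> 0" and c: "?c = 1 / T" and kap: "kap y = y * ?c - 1"
      using T y by (simp_all add: T_def coth_def kap_eq)
    define P where "P = 8 * (1 - T\<^sup>2) / T ^ 5"
    have "q4 y = P * ((3 - 2 * T\<^sup>2) * q4_core y)" by (simp add: q4_def P_def T_def)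
    also have "(3 - 2 * T\<^sup>2) * q4_core y = (3 - 2 * T\<^sup>2) * Kap2 y - T * (3 - T\<^sup>2) * Kap1 y
     + T * (9 * (y - T) - 2 * y * T\<^sup>2 + T * (y - T)) / 4"
    proof -
      have "d * (a - b / d * c + e / (4 * d)) = d * a - b * c + e / 4" if "d \<noteq> 0" for a b c d e :: real
        using that by (simp add: field_simps)
      from this[OF ne] show ?thesis unfolding q4_core_def T_def[symmetric] .
    qed
    also have "P * \<dots> = P * (3 - 2 * T\<^sup>2) * Kap2 y - P * (T * (3 - T\<^sup>2)) * Kap1 y
        + P * (T * (9 * (y - T) - 2 * y * T\<^sup>2 + T * (y - T)) / 4)"
      by (simp add: algebra_simps)
    also have "P * (3 - 2 * T\<^sup>2) = 8 * ?c * (1 - ?c\<^sup>2) * (2 - 3 * ?c\<^sup>2)"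
      using T' unfolding P_def c by (simp add: field_simps power_numeral_reduce)
    also have "P * (T * (3 - T\<^sup>2)) = 8 * (1 - ?c\<^sup>2) * (1 - 3 * ?c\<^sup>2)"
      using T' unfolding P_def c by (simp add: field_simps power_numeral_reduce)
    also have "P * (T * (9 * (y - T) - 2 * y * T\<^sup>2 + T * (y - T)) / 4) =
        2 * (1 - ?c\<^sup>2) * (1 - y * ?c) * (1 + ?c) + 4 * (?c + y * (1 - ?c\<^sup>2)) * (1 - ?c\<^sup>2)
        - 12 * kap y * ?c * (1 - ?c\<^sup>2)"
      using T' unfolding P_def kap c by (simp add: field_simps power_numeral_reduce)
    also have "8 * ?c * (1 - ?c\<^sup>2) * (2 - 3 * ?c\<^sup>2) * Kap2 y - 8 * (1 - ?c\<^sup>2) * (1 - 3 * ?c\<^sup>2) * Kap1 y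
        + (2 * (1 - ?c\<^sup>2) * (1 - y * ?c) * (1 + ?c) + 4 * (?c + y * (1 - ?c\<^sup>2)) * (1 - ?c\<^sup>2)
        - 12 * kap y * ?c * (1 - ?c\<^sup>2)) = ?d"
      by (simp only: algebra_simps)
    finally show ?thesis ..
  qed
  ultimately show "(q3 has_real_derivative q4 y) (at y)" by simp
qed

text \<open>
  The leading Taylor coefficients at \<open>0\<close>; the last two follow from the first by l'Hopital's rule.
\<close>
lemma Kap_limits:
  "((\<lambda>y. kap y / y\<^sup>2) \<longlongrightarrow> 1 / 3) (at_right 0)"
  "((\<lambda>y. Kap1 y / y ^ 3) \<longlongrightarrow> 1 / 9) (at_right 0)"
  "((\<lambda>y. Kap2 y / y ^ 4) \<longlongrightarrow> 1 / 36) (at_right 0)"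
proof -
  have pos: "eventually (\<lambda>y::real. y > 0) (at_right 0)"
    by (simp add: eventually_at_right_less)
  have lim0: "(Kap1 \<longlongrightarrow> 0) (at_right 0)" "(Kap2 \<longlongrightarrow> 0) (at_right 0)"
    using continuous_on_Kap1 continuous_on_Kap2
    by (auto simp: continuous_on_def dest!: bspec[of "{0..}" _ 0]
             intro: tendsto_within_subset[of _ _ 0 "{0..}" "{0<..}"])
  have "((\<lambda>y::real. (y / tanh y - 1) / y\<^sup>2) \<longlongrightarrow> 1 / 3) (at_right 0)"
    by real_asymp
  thus k: "((\<lambda>y. kap y / y\<^sup>2) \<longlongrightarrow> 1 / 3) (at_right 0)"
    by (rule Lim_transform_eventually) (use pos in eventually_elim, simp add: kap_def)
  show K1: "((\<lambda>y. Kap1 y / y ^ 3) \<longlongrightarrow> 1 / 9) (at_right 0)"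
  proof (rule lhopital_right_0)
    show "eventually (\<lambda>y. (Kap1 has_real_derivative kap y) (at y)) (at_right 0)"
      using pos by eventually_elim (rule Kap1_deriv)
    show "eventually (\<lambda>y::real. ((\<lambda>y. y ^ 3) has_real_derivative 3 * y\<^sup>2) (at y)) (at_right 0)"
      by (intro always_eventually allI) (auto intro!: derivative_eq_intros)
    show "((\<lambda>y. kap y / (3 * y\<^sup>2)) \<longlongrightarrow> 1 / 9) (at_right 0)"
      using tendsto_mult_left[OF k, of "1/3"] by simp
  qed (use pos in \<open>auto intro!: lim0 tendsto_eq_intros elim: eventually_mono\<close>)
  show "((\<lambda>y. Kap2 y / y ^ 4) \<longlongrightarrow> 1 / 36) (at_right 0)"
  proof (rule lhopital_right_0)
    show "eventually (\<lambda>y. (Kap2 has_real_derivative Kap1 y) (at y)) (at_right 0)"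
      using pos by eventually_elim (rule Kap2_deriv)
    show "eventually (\<lambda>y::real. ((\<lambda>y. y ^ 4) has_real_derivative 4 * y ^ 3) (at y)) (at_right 0)"
      by (intro always_eventually allI) (auto intro!: derivative_eq_intros)
    show "((\<lambda>y. Kap1 y / (4 * y ^ 3)) \<longlongrightarrow> 1 / 36) (at_right 0)"
      using tendsto_mult_left[OF K1, of "1/4"] by simp
  qed (use pos in \<open>auto intro!: lim0 tendsto_eq_intros elim: eventually_mono\<close>)
qed

text \<open>
  In terms of the quotients \<open>kap' y / y\<close>, \<open>kap y / y\<^sup>2\<close>, \<open>Kap1 y / y ^ 3\<close>, \<open>Kap2 y / y ^ 4\<close>, \<open>y coth y\<close> and
  \<open>y\<^sup>2 (1 - coth\<^sup>2 y)\<close>, which have finite limits, the poles of \<open>coth\<close> at \<open>0\<close> cancel. The value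
  \<open>1 / 6\<close> agrees with \<open>q0 y\<close> being asymptotic to \<open>y ^ 3 / 36\<close>.
\<close>
lemma q_limits_0:
  "(q0 \<longlongrightarrow> 0) (at_right 0)" "(q1 \<longlongrightarrow> 0) (at_right 0)"
  "(q2 \<longlongrightarrow> 0) (at_right 0)" "(q3 \<longlongrightarrow> 1 / 6) (at_right 0)"
proof -
  have pos: "eventually (\<lambda>y::real. y > 0) (at_right 0)"
    by (simp add: eventually_at_right_less)
  define a b e d u v where abs: "a = (\<lambda>y. Kap2 y / y ^ 4)" "b = (\<lambda>y. Kap1 y / y ^ 3)"
    "e = (\<lambda>y. kap y / y\<^sup>2)" "d = (\<lambda>y. (coth y + y * (1 - (coth y)\<^sup>2)) / y)"
    "u = (\<lambda>y. y * coth y)" "v = (\<lambda>y. y\<^sup>2 * (1 - (coth y)\<^sup>2))"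
  have lims: "(a \<longlongrightarrow> 1 / 36) (at_right 0)" "(b \<longlongrightarrow> 1 / 9) (at_right 0)" "(e \<longlongrightarrow> 1 / 3) (at_right 0)"
    using Kap_limits by (simp_all add: abs)
  have lims': "(d \<longlongrightarrow> 2 / 3) (at_right 0)" "(u \<longlongrightarrow> 1) (at_right 0)" "(v \<longlongrightarrow> -1) (at_right 0)"
    unfolding abs coth_def by real_asymp+
  have y0: "((\<lambda>y. y) \<longlongrightarrow> (0::real)) (at_right 0)" by (rule tendsto_ident_at)
  note L = lims lims' y0
  have "((\<lambda>y. y ^ 3 * a y * (y + u y)) \<longlongrightarrow> 0) (at_right 0)"
    by (auto intro!: tendsto_eq_intros L)
  thus "(q0 \<longlongrightarrow> 0) (at_right 0)"
    by (rule Lim_transform_eventually)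
       (use pos in eventually_elim, simp add: q0_def abs field_simps power_numeral_reduce)
  have "((\<lambda>y. y ^ 2 * (b y * (y + u y) + a y * v y)) \<longlongrightarrow> 0) (at_right 0)"
    by (auto intro!: tendsto_eq_intros L)
  thus "(q1 \<longlongrightarrow> 0) (at_right 0)"
    by (rule Lim_transform_eventually)
       (use pos in eventually_elim, simp add: q1_def abs field_simps power_numeral_reduce)
  have "((\<lambda>y. y * (e y * (y + u y) + 2 * b y * v y - 2 * a y * u y * v y)) \<longlongrightarrow> 0) (at_right 0)"
    by (auto intro!: tendsto_eq_intros L)
  thus "(q2 \<longlongrightarrow> 0) (at_right 0)"
    by (rule Lim_transform_eventually)
       (use pos in eventually_elim, simp add: q2_def abs field_simps power_numeral_reduce)
  have "((\<lambda>y. d y * (y + u y) + 3 * e y * v y - 6 * b y * u y * v y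
          - 2 * a y * v y * (y\<^sup>2 - 3 * (u y)\<^sup>2)) \<longlongrightarrow> 1 / 6) (at_right 0)"
    by (auto intro!: tendsto_eq_intros L)
  thus "(q3 \<longlongrightarrow> 1 / 6) (at_right 0)"
    by (rule Lim_transform_eventually)
       (use pos in eventually_elim, simp add: q3_def abs field_simps power_numeral_reduce)
qed

text \<open>
  Only the first summand of \<open>q3\<close> survives: in the others \<open>1 - coth\<^sup>2\<close> decays exponentially,
  whereas \<open>kap\<close>, \<open>Kap1\<close> and \<open>Kap2\<close> grow at most polynomially.
\<close>
lemma q3_limit_top: "(q3 \<longlongrightarrow> 2) at_top"
proof -
  have bound: "((\<lambda>y. F y * (1 - (coth y)\<^sup>2)) \<longlongrightarrow> 0) at_top"
    if g: "((\<lambda>y. g y * \<bar>1 - (coth y)\<^sup>2\<bar>) \<longlongrightarrow> 0) at_top"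
      and F: "\<And>y. y \<ge> 0 \<Longrightarrow> 0 \<le> F y" "\<And>y. y \<ge> 0 \<Longrightarrow> F y \<le> g y" for F g :: "real \<Rightarrow> real"
  proof (rule Lim_null_comparison[OF _ g])
    show "eventually (\<lambda>y. norm (F y * (1 - (coth y)\<^sup>2)) \<le> g y * \<bar>1 - (coth y)\<^sup>2\<bar>) at_top"
      using eventually_gt_at_top[of 0]
      by eventually_elim (use F in \<open>auto simp: abs_mult intro!: mult_right_mono\<close>)
  qed
  have g: "((\<lambda>y. y * \<bar>1 - (coth y)\<^sup>2\<bar>) \<longlongrightarrow> 0) at_top"
    "((\<lambda>y. y\<^sup>2 / 2 * \<bar>1 - (coth y)\<^sup>2\<bar>) \<longlongrightarrow> 0) at_top"
    "((\<lambda>y. y ^ 3 / 6 * \<bar>1 - (coth y)\<^sup>2\<bar>) \<longlongrightarrow> 0) at_top"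
    unfolding coth_def by real_asymp+
  have "((\<lambda>y. y * (1 - (coth y)\<^sup>2)) \<longlongrightarrow> 0) at_top" "((\<lambda>y. kap y * (1 - (coth y)\<^sup>2)) \<longlongrightarrow> 0) at_top"
    "((\<lambda>y. Kap1 y * (1 - (coth y)\<^sup>2)) \<longlongrightarrow> 0) at_top"
    "((\<lambda>y. Kap2 y * (1 - (coth y)\<^sup>2)) \<longlongrightarrow> 0) at_top"
    using kap_nonneg kap_le Kap1_nonneg Kap1_le Kap2_nonneg Kap2_le
    by (auto intro: bound[OF g(1)] bound[OF g(2)] bound[OF g(3)])
  moreover have "(coth \<longlongrightarrow> 1) at_top"
    unfolding coth_def[abs_def] by real_asymp
  moreover have "((\<lambda>y. (coth y + A y) * (1 + coth y) + 3 * B y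
     - 6 * C y * coth y - 2 * D y * (1 - 3 * (coth y)\<^sup>2)) \<longlongrightarrow> 2) at_top"
    if "(A \<longlongrightarrow> 0) at_top" "(B \<longlongrightarrow> 0) at_top" "(C \<longlongrightarrow> 0) at_top" "(D \<longlongrightarrow> 0) at_top"
      "(coth \<longlongrightarrow> 1) at_top" for A B C D :: "real \<Rightarrow> real"
    by (rule tendsto_eq_rhs) (rule tendsto_intros that | simp)+
  ultimately have "((\<lambda>y. (coth y + y * (1 - (coth y)\<^sup>2)) * (1 + coth y) + 3 * (kap y * (1 - (coth y)\<^sup>2))
     - 6 * (Kap1 y * (1 - (coth y)\<^sup>2)) * coth y
     - 2 * (Kap2 y * (1 - (coth y)\<^sup>2)) * (1 - 3 * (coth y)\<^sup>2)) \<longlongrightarrow> 2) at_top"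
    by blast
  thus ?thesis by (simp add: q3_def[abs_def] mult_ac)
qed

lemma continuous_on_q:
  "continuous_on {0<..} q0" "continuous_on {0<..} q1" "continuous_on {0<..} q2"
  "continuous_on {0<..} q3" "continuous_on {0<..} q4"
proof -
  show "continuous_on {0<..} q0" "continuous_on {0<..} q1" "continuous_on {0<..} q2"
    "continuous_on {0<..} q3"
    using q_derivs by (auto intro!: continuous_at_imp_continuous_on DERIV_isCont)
  show "continuous_on {0<..} q4"
    unfolding q4_def[abs_def]
    by (auto intro!: continuous_intros continuous_on_subset[OF continuous_on_q4_core])
qed

text \<open>
  The function \<open>q3\<close> increases from its limit at \<open>0\<close> to its limit at infinity.
\<close>
lemma q3_bounds:
  assumes y: "y > 0" shows "1 / 6 \<le> q3 y" "q3 y \<le> 2"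
proof -
  have mono: "q3 x \<le> q3 z" if "0 < x" "x \<le> z" for x z
    by (rule DERIV_nonneg_imp_nondecreasing[OF that(2)])
       (use that(1) in \<open>auto intro!: exI q_derivs(4) q4_nonneg\<close>)
  have "eventually (\<lambda>x. q3 x \<le> q3 y) (at_right 0)"
    using eventually_at_right_less eventually_at_right_real[OF y]
    by eventually_elim (auto intro: mono)
  thus "1 / 6 \<le> q3 y"
    by (intro tendsto_upperbound[OF q_limits_0(4)]) auto
  have "eventually (\<lambda>x. q3 y \<le> q3 x) at_top"
    using eventually_ge_at_top[of y] by eventually_elim (use y in \<open>auto intro: mono\<close>)
  thus "q3 y \<le> 2"
    by (intro tendsto_lowerbound[OF q3_limit_top]) auto
qed

text \<open>
  This passes growth bounds from \<open>q3\<close> down to \<open>q2\<close>, \<open>q1\<close>, \<open>q0\<close>, without any estimate of \<open>coth\<close>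
  near its pole.
\<close>
lemma abs_le_power_if_deriv:
  fixes f f' :: "real \<Rightarrow> real"
  assumes f: "\<And>x. x > 0 \<Longrightarrow> (f has_real_derivative f' x) (at x)"
    and lim: "(f \<longlongrightarrow> 0) (at_right 0)"
    and bound: "\<And>x. x > 0 \<Longrightarrow> \<bar>f' x\<bar> \<le> B * x ^ n" and y: "y > 0"
  shows "\<bar>f y\<bar> \<le> B * y ^ Suc n"
proof -
  have "0 \<le> B * 1 ^ n" using bound[of 1] by (metis abs_ge_zero order_trans zero_less_one)
  hence B: "B \<ge> 0" by simp
  have *: "\<bar>f y - f x\<bar> \<le> B * y ^ Suc n" if x: "0 < x" "x < y" for x
  proof -
    obtain z where z: "x < z" "z < y" "f y - f x = (y - x) * f' z"
      using MVT2[of x y f f'] x f by auto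
    have "\<bar>f' z\<bar> \<le> B * y ^ n"
      using bound[of z] z x B
      by (auto intro!: order_trans[OF bound[of z]] mult_left_mono power_mono)
    hence "(y - x) * \<bar>f' z\<bar> \<le> y * (B * y ^ n)"
      using x by (intro mult_mono) auto
    thus ?thesis using z x by (simp add: abs_mult mult_ac)
  qed
  have "((\<lambda>x. \<bar>f y - f x\<bar>) \<longlongrightarrow> \<bar>f y - 0\<bar>) (at_right 0)"
    by (intro tendsto_intros lim)
  moreover have "eventually (\<lambda>x. \<bar>f y - f x\<bar> \<le> B * y ^ Suc n) (at_right 0)"
    using eventually_at_right_less eventually_at_right_real[OF y]
    by eventually_elim (use * in auto)
  ultimately have "\<bar>f y - 0\<bar> \<le> B * y ^ Suc n"
    by (rule tendsto_upperbound) auto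
  thus ?thesis by simp
qed

lemma subexponential_if_power_bound:
  assumes "\<And>y. y > 0 \<Longrightarrow> \<bar>f y\<bar> \<le> C * y ^ n"
  shows "subexponential f"
  by (rule subexponential_bound[OF _ assms])
     (intro subexponential_mult subexponential_const subexponential_power subexponential_id)

lemma subexponential_q:
  "subexponential q0" "subexponential q1" "subexponential q2" "subexponential q3"
proof -
  have b3: "\<bar>q3 y\<bar> \<le> 2 * y ^ 0" if "y > 0" for y using q3_bounds[OF that] by simp
  note b2 = abs_le_power_if_deriv[OF q_derivs(3) q_limits_0(3) b3]
  note b1 = abs_le_power_if_deriv[OF q_derivs(2) q_limits_0(2) b2]
  note b0 = abs_le_power_if_deriv[OF q_derivs(1) q_limits_0(1) b1]
  show "subexponential q0" by (rule subexponential_if_power_bound[OF b0])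
  show "subexponential q1" by (rule subexponential_if_power_bound[OF b1])
  show "subexponential q2" by (rule subexponential_if_power_bound[OF b2])
  show "subexponential q3" by (rule subexponential_if_power_bound[OF b3])
qed

lemma laplace_converges_q4: "laplace_converges q4"
  by (rule laplace_convergesI_nonneg[OF q_derivs(4) continuous_on_q(5) q4_nonneg
        q_limits_0(4) q3_limit_top])

lemma laplace_q0:
  assumes s: "s > 0"
  shows "s ^ 4 * laplace q0 s = 1 / 6 + laplace q4 s"
proof -
  have conv: "laplace_converges q0" "laplace_converges q1" "laplace_converges q2" "laplace_converges q3"
    by (auto intro: laplace_convergesI subexponential_q continuous_on_q)
  note * = laplace_derivative[OF _ _ _ _ _ subexponential_tendsto_0 s]
  have "s * laplace q0 s = 0 + laplace q1 s"
    by (intro * q_derivs continuous_on_q conv q_limits_0 subexponential_q s)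
  moreover have "s * laplace q1 s = 0 + laplace q2 s"
    by (intro * q_derivs continuous_on_q conv q_limits_0 subexponential_q s)
  moreover have "s * laplace q2 s = 0 + laplace q3 s"
    by (intro * q_derivs continuous_on_q conv q_limits_0 subexponential_q s)
  moreover have "s * laplace q3 s = 1 / 6 + laplace q4 s"
    by (intro * q_derivs continuous_on_q conv laplace_converges_q4 q_limits_0 subexponential_q s)
  ultimately show ?thesis by (simp add: power4_eq_xxxx mult.assoc)
qed

lemma subexponential_kap: "subexponential kap"
  by (rule subexponential_if_power_bound[of _ 1 1]) (use kap_nonneg kap_le in auto)

lemma subexponential_Kap1: "subexponential Kap1"
  by (rule subexponential_if_power_bound[of _ "1/2" 2]) (use Kap1_nonneg Kap1_le in auto)

lemma subexponential_Kap2: "subexponential Kap2"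
  by (rule subexponential_if_power_bound[of _ "1/6" 3]) (use Kap2_nonneg Kap2_le in auto)

lemma laplace_converges_Kap:
  "laplace_converges kap" "laplace_converges Kap1" "laplace_converges Kap2"
  by (auto intro!: laplace_convergesI subexponential_kap subexponential_Kap1 subexponential_Kap2
      continuous_on_subset[OF continuous_on_kap] continuous_on_subset[OF continuous_on_Kap1]
      continuous_on_subset[OF continuous_on_Kap2])

lemma laplace_Kap2:
  assumes s: "s > 0" shows "s\<^sup>2 * laplace Kap2 s = laplace kap s"
proof -
  have lim: "(Kap1 \<longlongrightarrow> 0) (at_right 0)" "(Kap2 \<longlongrightarrow> 0) (at_right 0)"
    using continuous_on_Kap1 continuous_on_Kap2
    by (auto simp: continuous_on_def dest!: bspec[of "{0..}" _ 0]
             intro: tendsto_within_subset[of _ _ 0 "{0..}" "{0<..}"])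
  note * = laplace_derivative[OF _ _ _ _ _ subexponential_tendsto_0 s]
  have "s * laplace Kap2 s = 0 + laplace Kap1 s" "s * laplace Kap1 s = 0 + laplace kap s"
    by (intro * Kap1_deriv Kap2_deriv laplace_converges_Kap lim subexponential_Kap1
        subexponential_Kap2 s continuous_on_subset[OF continuous_on_kap]
        continuous_on_subset[OF continuous_on_Kap1]; force)+
  thus ?thesis by (simp add: power2_eq_square mult.assoc)
qed

section \<open>Laplace representations of the trigamma function and of \<open>Psi\<close>\<close>

text \<open>
  Here \<open>1 + coth y = 2 / (1 - exp (- 2 y))\<close>: the factor \<open>1 + coth\<close> in a kernel is inverted by
  forming a difference with step \<open>2\<close> of the transform.
\<close>
lemma one_plus_coth: "y > 0 \<Longrightarrow> (1 - exp (- 2 * y)) * (1 + coth y) = 2"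
  by (simp add: coth_def tanh_real_altdef divide_simps)

lemma one_plus_coth_times:
  assumes "y > 0"
  shows "k * (1 + coth y) = exp (- 2 * y) * (k * (1 + coth y)) + 2 * k"
proof -
  have "k * (1 + coth y) = exp (- 2 * y) * (k * (1 + coth y)) + k * ((1 - exp (- 2 * y)) * (1 + coth y))"
    by (simp add: algebra_simps)
  thus ?thesis unfolding one_plus_coth[OF assms] by simp
qed

lemma laplace_one_plus_coth:
  assumes f: "laplace_converges (\<lambda>y. f y * (1 + coth y))" "laplace_converges f" and s: "s > 0"
  shows "laplace (\<lambda>y. f y * (1 + coth y)) s =
    laplace (\<lambda>y. f y * (1 + coth y)) (s + 2) + 2 * laplace f s"
proof -
  let ?g = "\<lambda>y. f y * (1 + coth y)"
  have "laplace_converges (\<lambda>y. exp (- 2 * y) * ?g y)"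
    unfolding laplace_converges_def
  proof safe
    fix s :: real assume "s > 0"
    thus "set_integrable lborel {0<..} (\<lambda>y. exp (- s * y) * (exp (- 2 * y) * ?g y))"
      using laplace_convergesD[OF f(1), of "s + 2"]
      by (simp add: algebra_simps flip: exp_add mult.assoc)
  qed
  hence "laplace (\<lambda>y. exp (- 2 * y) * ?g y + 2 * f y) s = laplace ?g (s + 2) + 2 * laplace f s"
    by (simp only: laplace_add laplace_converges_cmult[OF f(2)] s laplace_mult_exp laplace_cmult)
  moreover have "laplace ?g s = laplace (\<lambda>y. exp (- 2 * y) * ?g y + 2 * f y) s"
    by (intro laplace_cong one_plus_coth_times)
  ultimately show ?thesis by simp
qed

lemma Polygamma_tendsto_0:
  assumes "x > (0::real)" "n > 0"
  shows "(\<lambda>m. Polygamma n (x + of_nat m)) \<longlonglongrightarrow> 0"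
proof -
  have x: "x \<notin> \<int>\<^sub>\<le>\<^sub>0" using assms by (auto simp: nonpos_Ints_def)
  have "(\<lambda>m. \<Sum>k<m. inverse ((x + of_nat k) ^ Suc n)) \<longlonglongrightarrow> ((-1) ^ Suc n * Polygamma n x / fact n)"
    using Polygamma_LIMSEQ[of x n] assms by (simp add: sums_def)
  hence "(\<lambda>m. Polygamma n x + (-1) ^ n * fact n * (\<Sum>k<m. inverse ((x + of_nat k) ^ Suc n))) \<longlonglongrightarrow>
     Polygamma n x + (-1) ^ n * fact n * ((-1) ^ Suc n * Polygamma n x / fact n)"
    by (intro tendsto_intros)
  also have "Polygamma n x + (-1) ^ n * fact n * ((-1) ^ Suc n * Polygamma n x / fact n) = 0"
    by (simp add: mult.assoc[symmetric] flip: power_mult_distrib)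
  finally show ?thesis using assms
    by (subst Polygamma_plus_of_nat) (auto simp: inverse_eq_divide simp del: power_Suc)
qed

lemma laplace_dilated_tendsto_0:
  assumes "laplace_converges f" "x > 0"
  shows "(\<lambda>m. laplace f (2 * (x + of_nat m))) \<longlonglongrightarrow> 0"
proof -
  have "strict_mono (\<lambda>m::nat. 2 * m)" by (auto simp: strict_mono_def)
  from LIMSEQ_subseq_LIMSEQ[OF laplace_tendsto_0[OF assms(1), of "2 * x"] this]
  show ?thesis using assms(2) by (simp add: o_def algebra_simps)
qed

text \<open>
  The uniqueness principle behind both identifications of Laplace transforms below: the difference
  of two solutions of the same first-order difference equation is \<open>1\<close>-periodic.
\<close>
lemma periodic_null_imp_zero:
  fixes d :: "real \<Rightarrow> real"
  assumes per: "\<And>x. x > 0 \<Longrightarrow> d (x + 1) = d x"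
    and lim: "\<And>x. x > 0 \<Longrightarrow> (\<lambda>m. d (x + of_nat m)) \<longlonglongrightarrow> 0" and x: "x > 0"
  shows "d x = 0"
proof -
  have "d (x + of_nat m) = d x" for m
  proof (induction m)
    case (Suc m)
    thus ?case using per[of "x + of_nat m"] x by (simp add: add_ac)
  qed simp
  with lim[OF x] show ?thesis by (simp add: LIMSEQ_const_iff)
qed

lemma Polygamma_1_plus1:
  assumes "x > (0::real)"
  shows "Polygamma 1 (x + 1) = Polygamma 1 x - 1 / x\<^sup>2"
    "Polygamma 2 (x + 1) = Polygamma 2 x + 2 / x ^ 3"
  using Polygamma_plus1[of x 1] Polygamma_plus1[of x 2] assms
  by (simp_all add: numeral_eq_Suc)

text \<open>
  Both \<open>Polygamma 1 x\<close> and \<open>2\<close> times the transform of \<open>y (1 + coth y) = kap y + 1 + y\<close> at \<open>2 x\<close> tend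
  to \<open>0\<close> along \<open>x + m\<close> and decrease by \<open>1 / x\<^sup>2\<close> when \<open>x\<close> is replaced by \<open>x + 1\<close>.
\<close>
lemma trigamma_laplace:
  assumes x: "x > 0"
  shows "Polygamma 1 x = 1 / x + 1 / (2 * x\<^sup>2) + 2 * laplace kap (2 * x)"
proof -
  let ?g = "\<lambda>y. y * (1 + coth y)"
  have g: "kap y + (1 + y) = ?g y" if "y > 0" for y
    using that by (simp add: kap_eq algebra_simps)
  have conv1: "laplace_converges (\<lambda>_. 1)" "laplace_converges (\<lambda>y. y)"
    by (auto intro!: laplace_convergesI subexponential_const subexponential_id continuous_intros)
  have "laplace_converges (\<lambda>y. kap y + (1 + y))"
    by (intro laplace_converges_add laplace_converges_Kap conv1)
  hence conv: "laplace_converges ?g"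
    using laplace_converges_cong[OF g] by simp
  have g': "laplace ?g s = laplace kap s + (1 / s + 1 / s\<^sup>2)" if "s > 0" for s
    using that
    by (subst laplace_cong[OF g, symmetric])
       (simp_all add: laplace_add laplace_converges_add laplace_converges_Kap conv1 laplace_const laplace_id)
  have "Polygamma 1 x - 2 * laplace ?g (2 * x) = 0"
  proof (rule periodic_null_imp_zero[OF _ _ x])
    fix x :: real assume x: "x > 0"
    have "laplace ?g (2 * x) = laplace ?g (2 * x + 2) + 2 * (1 / (2 * x)\<^sup>2)"
      using laplace_one_plus_coth[OF conv conv1(2), of "2 * x"] x by (simp add: laplace_id)
    thus "Polygamma 1 (x + 1) - 2 * laplace ?g (2 * (x + 1)) = Polygamma 1 x - 2 * laplace ?g (2 * x)"
      using Polygamma_1_plus1(1)[OF x] x by (simp add: power2_eq_square algebra_simps)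
    show "(\<lambda>m. Polygamma 1 (x + of_nat m) - 2 * laplace ?g (2 * (x + of_nat m))) \<longlonglongrightarrow> 0"
      using tendsto_diff[OF Polygamma_tendsto_0[OF x, of 1]
          tendsto_mult_right_zero[OF laplace_dilated_tendsto_0[OF conv x], of 2]] by simp
  qed
  thus ?thesis using x g'[of "2 * x"] by (simp add: power2_eq_square)
qed

lemma Psi_eq_Polygamma:
  assumes x: "x > 0"
  shows "Psi x = (Polygamma 1 x)\<^sup>2 + Polygamma 2 x"
proof -
  have nonpos: "x \<notin> \<int>\<^sub>\<le>\<^sub>0" if "x > 0" for x :: real using that by (auto simp: nonpos_Ints_def)
  have psi: "psi x = Digamma x" if "x > 0" for x
  proof -
    have "deriv Gamma x = Gamma x * Digamma x"
      by (rule DERIV_imp_deriv) (rule has_field_derivative_Gamma[OF nonpos[OF that]])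
    thus ?thesis using Gamma_real_pos[OF that] by (simp add: psi_def)
  qed
  have d1: "deriv psi x = Polygamma 1 x" if "x > 0" for x
  proof (rule DERIV_imp_deriv, rule has_field_derivative_transform_within_open[where S = "{0<..}"])
    show "(Digamma has_real_derivative Polygamma 1 x) (at x)"
      using has_field_derivative_Polygamma[OF nonpos[OF that], of 0] by simp
  qed (use that psi in auto)
  have "deriv (deriv psi) x = Polygamma 2 x"
  proof (rule DERIV_imp_deriv, rule has_field_derivative_transform_within_open[where S = "{0<..}"])
    show "(Polygamma 1 has_real_derivative Polygamma 2 x) (at x)"
      using has_field_derivative_Polygamma[OF nonpos[OF x], of 1] by (simp add: numeral_2_eq_2)
  qed (use x d1 in auto)
  thus ?thesis by (simp add: Psi_def d1[OF x])
qed

text \<open>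
  The recurrences of the polygamma functions give
  \<open>Psi x - Psi (x + 1) = 2 / x\<^sup>2 * (Polygamma 1 x - 1 / x - 1 / (2 x\<^sup>2))\<close>. The bracket is
  \<open>2 laplace kap (2 x) = 8 x\<^sup>2 laplace Kap2 (2 x)\<close>, so that the right-hand side equals
  \<open>16 laplace Kap2 (2 x)\<close>, and \<open>8 laplace q0 (2 x)\<close> has the same increment.
\<close>
lemma Psi_laplace:
  assumes x: "x > 0"
  shows "Psi x = 8 * laplace q0 (2 * x)"
proof -
  have conv: "laplace_converges q0" "laplace_converges Kap2"
    by (auto intro: laplace_convergesI subexponential_q continuous_on_q laplace_converges_Kap)
  have "(Polygamma 1 x)\<^sup>2 + Polygamma 2 x - 8 * laplace q0 (2 * x) = 0"
  proof (rule periodic_null_imp_zero[OF _ _ x])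
    fix x :: real assume x: "x > 0"
    have q: "laplace q0 (2 * x) = laplace q0 (2 * (x + 1)) + 2 * laplace Kap2 (2 * x)"
      using laplace_one_plus_coth[OF conv[unfolded q0_def[abs_def]], of "2 * x"] x
      by (simp add: q0_def[abs_def] algebra_simps)
    have "Polygamma 1 x = 1 / x + 1 / (2 * x\<^sup>2) + 8 * x\<^sup>2 * laplace Kap2 (2 * x)"
      using trigamma_laplace[OF x] laplace_Kap2[of "2 * x"] x by (simp add: power2_eq_square)
    hence K: "16 * laplace Kap2 (2 * x) = 2 / x\<^sup>2 * (Polygamma 1 x - 1 / x - 1 / (2 * x\<^sup>2))"
      using x by (simp add: field_simps)
    have "(Polygamma 1 x)\<^sup>2 + Polygamma 2 x =
      (Polygamma 1 (x + 1))\<^sup>2 + Polygamma 2 (x + 1) + 2 / x\<^sup>2 * (Polygamma 1 x - 1 / x - 1 / (2 * x\<^sup>2))"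
      unfolding Polygamma_1_plus1[OF x] using x by (simp add: field_simps power_numeral_reduce)
    thus "(Polygamma 1 (x + 1))\<^sup>2 + Polygamma 2 (x + 1) - 8 * laplace q0 (2 * (x + 1)) =
       (Polygamma 1 x)\<^sup>2 + Polygamma 2 x - 8 * laplace q0 (2 * x)"
      using q K by simp
    have "(\<lambda>m. (Polygamma 1 (x + of_nat m))\<^sup>2 + Polygamma 2 (x + of_nat m)
        - 8 * laplace q0 (2 * (x + of_nat m))) \<longlonglongrightarrow> 0\<^sup>2 + 0 - 8 * 0"
      by (intro tendsto_add tendsto_diff tendsto_power tendsto_mult tendsto_const
          Polygamma_tendsto_0 laplace_dilated_tendsto_0[OF conv(1)] x) auto
    thus "(\<lambda>m. (Polygamma 1 (x + of_nat m))\<^sup>2 + Polygamma 2 (x + of_nat m)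
        - 8 * laplace q0 (2 * (x + of_nat m))) \<longlonglongrightarrow> 0"
      by simp
  qed
  thus ?thesis using Psi_eq_Polygamma[OF x] by simp
qed

lemma power4_times_Psi:
  assumes "x > 0"
  shows "x ^ 4 * Psi x = 1 / 12 + 1 / 2 * laplace q4 (2 * x)"
  using laplace_q0[of "2 * x"] Psi_laplace[OF assms] assms by (simp add: power_mult_distrib)

section \<open>Complete monotonicity and the degree\<close>

text \<open>
  The easy half of Bernstein's theorem: the \<open>k\<close>-th derivative of the transform of \<open>f\<close> is the
  transform of \<open>(- y) ^ k * f y\<close>.
\<close>
lemma completely_monotonic_on_laplace:
  assumes f: "laplace_converges f" "\<And>y. y > 0 \<Longrightarrow> f y \<ge> 0"
    and nonneg: "a \<ge> 0" "b \<ge> 0" "c > 0"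
  shows "completely_monotonic_on {0<..} (\<lambda>x. a + b * laplace f (c * x))"
proof -
  let ?f = "\<lambda>k y. (- y) ^ k * f y"
  let ?D = "\<lambda>k x. (if k = 0 then a else 0) + b * c ^ k * laplace (?f k) (c * x)"
  have conv: "laplace_converges (?f k)" for k
  proof (induction k)
    case (Suc k)
    from laplace_converges_cmult[OF laplace_converges_times_id[OF this], of "-1"]
    show ?case by (simp add: mult_ac)
  qed (use f in simp)
  show ?thesis
    unfolding completely_monotonic_on_def
  proof (intro exI[of _ ?D] conjI allI ballI)
    fix k :: nat and x :: real assume x: "x \<in> {0<..}"
    have "(laplace (?f k) has_real_derivative laplace (\<lambda>y. - y * ?f k y) (c * x)) (at (c * x))"
      by (rule has_real_derivative_laplace[OF conv]) (use x nonneg in auto)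
    also have "(\<lambda>y. - y * ?f k y) = ?f (Suc k)" by (auto simp: mult_ac)
    finally have d: "((\<lambda>x. laplace (?f k) (c * x)) has_real_derivative laplace (?f (Suc k)) (c * x) * c) (at x)"
      by (rule DERIV_chain2) (auto intro!: derivative_eq_intros)
    have "(?D k has_real_derivative 0 + b * c ^ k * (laplace (?f (Suc k)) (c * x) * c)) (at x)"
      by (intro DERIV_add DERIV_const DERIV_cmult d)
    hence "(?D k has_real_derivative ?D (Suc k) x) (at x)"
      by (simp add: mult_ac)
    thus "(?D k has_real_derivative ?D (Suc k) x) (at x within {0<..})"
      by (rule has_field_derivative_at_within)
    have "(-1) ^ k * laplace (?f k) (c * x) = laplace (\<lambda>y. y ^ k * f y) (c * x)"
      unfolding laplace_cmult[symmetric]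
      by (intro laplace_cong) (simp flip: mult.assoc power_mult_distrib)
    also have "\<dots> \<ge> 0" using f(2) by (intro laplace_nonneg) simp
    finally have L: "0 \<le> (-1) ^ k * laplace (?f k) (c * x)" .
    have "0 \<le> (if k = 0 then a else 0) + b * c ^ k * ((-1) ^ k * laplace (?f k) (c * x))"
      using nonneg by (intro add_nonneg_nonneg mult_nonneg_nonneg[OF _ L]) auto
    also have "\<dots> = (-1) ^ k * ?D k x"
      by (simp add: distrib_left mult_ac)
    finally show "0 \<le> (-1) ^ k * ?D k x" .
  qed simp
qed

lemma completely_monotonic_on_cong:
  assumes "\<And>x. x \<in> I \<Longrightarrow> f x = g x"
  shows "completely_monotonic_on I f \<longleftrightarrow> completely_monotonic_on I g"
  using assms by (simp add: completely_monotonic_on_def)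

lemma completely_monotonic_on_antimono:
  assumes f: "completely_monotonic_on {0<..} f" and xy: "0 < x" "x \<le> y"
  shows "f y \<le> f x"
proof -
  obtain D where D: "\<forall>x\<in>{0<..}. D 0 x = f x"
    "\<And>k x. x \<in> {0<..} \<Longrightarrow> (D k has_real_derivative D (Suc k) x) (at x within {0<..})"
    "\<And>k x. x \<in> {0<..} \<Longrightarrow> 0 \<le> (-1) ^ k * D k x"
    using f unfolding completely_monotonic_on_def by blast
  have "D 0 y \<le> D 0 x"
  proof (rule DERIV_nonpos_imp_nonincreasing[OF xy(2)])
    fix t assume "x \<le> t" "t \<le> y"
    hence t: "t \<in> {0<..}" using xy by auto
    hence "(D 0 has_real_derivative D 1 t) (at t)"
      using D(2)[OF t, of 0] at_within_open[OF t] by simp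
    moreover have "D 1 t \<le> 0" using D(3)[OF t, of 1] by simp
    ultimately show "\<exists>d. (D 0 has_real_derivative d) (at t) \<and> d \<le> 0" by blast
  qed
  thus ?thesis using D(1) xy by simp
qed

theorem theorem1p1:
  shows "has_cm_degree Psi (ereal 4)"
proof -
  have cm_Psi: "completely_monotonic_on {0<..} Psi"
  proof -
    have "laplace_converges q0"
      by (auto intro: laplace_convergesI subexponential_q continuous_on_q)
    moreover have "q0 y \<ge> 0" if "y > 0" for y
      using that Kap2_nonneg[of y] by (simp add: q0_def coth_def)
    ultimately have "completely_monotonic_on {0<..} (\<lambda>x. 0 + 8 * laplace q0 (2 * x))"
      by (rule completely_monotonic_on_laplace) auto
    thus ?thesis by (subst completely_monotonic_on_cong) (auto simp: Psi_laplace)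
  qed
  have cm4: "completely_monotonic_on {0<..} (\<lambda>x. x ^ 4 * Psi x)"
  proof -
    have "completely_monotonic_on {0<..} (\<lambda>x. 1 / 12 + 1 / 2 * laplace q4 (2 * x))"
      by (rule completely_monotonic_on_laplace[OF laplace_converges_q4 q4_nonneg]) auto
    thus ?thesis by (subst completely_monotonic_on_cong) (auto simp: power4_times_Psi)
  qed
  have lower: "1 / 12 \<le> x ^ 4 * Psi x" if "x > 0" for x
    using power4_times_Psi[OF that] laplace_nonneg[of q4 "2 * x"] q4_nonneg by simp
  have "(Psi \<longlongrightarrow> 0) at_top"
  proof (rule tendsto_sandwich)
    show "eventually (\<lambda>x. 0 \<le> Psi x) at_top"
      using eventually_gt_at_top[of 0]
    proof eventually_elim
      case (elim x)
      with lower[OF elim] have "0 < x ^ 4 * Psi x" by linarith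
      thus ?case using elim by (simp add: zero_less_mult_iff)
    qed
    show "eventually (\<lambda>x. Psi x \<le> Psi 1 / x ^ 4) at_top"
      using eventually_ge_at_top[of 1]
    proof eventually_elim
      case (elim x)
      with completely_monotonic_on_antimono[OF cm4, of 1 x] show ?case
        by (simp add: field_simps)
    qed
    show "((\<lambda>x. Psi 1 / x ^ 4) \<longlongrightarrow> 0) at_top"
      by real_asymp
  qed auto
  hence Lim: "Lim at_top Psi = 0"
    by (rule tendsto_Lim[rotated]) simp
  have "completely_monotonic_on {0<..} (\<lambda>x. x powr 4 * Psi x)"
    using cm4 by (subst completely_monotonic_on_cong) (auto simp: powr_numeral)
  moreover have "\<not> completely_monotonic_on {0<..} (\<lambda>x. x powr (4 + \<epsilon>) * Psi x)" if \<epsilon>: "\<epsilon> > 0" for \<epsilon>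
  proof
    assume cm: "completely_monotonic_on {0<..} (\<lambda>x. x powr (4 + \<epsilon>) * Psi x)"
    \<comment> \<open>A completely monotonic function is bounded on \<open>[1, \<infinity>)\<close> by its value at \<open>1\<close>.\<close>
    have "eventually (\<lambda>x. x powr \<epsilon> * (1 / 12) \<le> Psi 1) at_top"
      using eventually_ge_at_top[of 1]
    proof eventually_elim
      case (elim x)
      have "x powr \<epsilon> * (1 / 12) \<le> x powr \<epsilon> * (x ^ 4 * Psi x)"
        using lower[of x] elim by (intro mult_left_mono) auto
      also have "\<dots> = x powr (4 + \<epsilon>) * Psi x"
        using elim by (simp add: powr_add powr_numeral)
      also have "\<dots> \<le> Psi 1"
        using completely_monotonic_on_antimono[OF cm, of 1 x] elim by simp
      finally show ?case .
    qed
    moreover have "filterlim (\<lambda>x. x powr \<epsilon> * (1 / 12)) at_top at_top"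
      using \<epsilon> by real_asymp
    hence "eventually (\<lambda>x. Psi 1 < x powr \<epsilon> * (1 / 12)) at_top"
      by (simp add: filterlim_at_top_dense)
    ultimately have "eventually (\<lambda>x::real. False) at_top"
      by eventually_elim auto
    thus False by simp
  qed
  ultimately show ?thesis
    using cm_Psi by (simp add: has_cm_degree_def Lim)
qed

end
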